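(* Let $n\ge 1$ and let $\pi=(d_1,\ldots,d_n)$ be a graphic sequence with $d_1\ge d_2\ge\cdots\ge d_n$, $d_1\ge n-3$ and $d_n\ge 3$. Then $\pi$ has a $Z_3$-connected realization unless $\pi$ is one of the following: $(n-3,3^{n-1})$ (for any $n$); or, with $k=n-1$ and $n$ even, $(k,3^k)$ or $(k^2,3^{k-1})$.
   Context: A sequence of integers $\pi$ is graphic if there is a simple graph $G$ whose degree sequence is $\pi$; such $G$ is a realization of $\pi$. Exponents denote multiplicities, e.g. $(k^2,3^{k-1})$ means $k$ appears twice and $3$ appears $k-1$ times. $Z_3$ is the cyclic group of order 3. For a graph $G$ (possibly with multiple edges, no loops) with an orientation and a map $f:E(G)\to Z_3$, the boundary $\partial f:V(G)\to Z_3$ is $\partial f(v)=\sum_{e\text{ with tail }v}f(e)-\sum_{e\text{ with head }v}f(e)$. A map $b:V(G)\to Z_3$ is zero-sum if $\sum_{v}b(v)=0$. $G$ is $Z_3$-connected if for every zero-sum $b$ there exist an orientation of $G$ and a map $f:E(G)\to Z_3\setminus\{0\}$ with $\partial f=b$. A $Z_3$-connected realization of $\pi$ is a realization of $\pi$ that is $Z_3$-connected. *)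

theory Defs
  imports "HOL-Library.Multiset" "HOL-Library.Numeral_Type"
begin

type_synonym Z3 = 3  (* the ring of integers modulo 3, of which only the additive group is used *)

(* Parallel edges are distinct edge names with the same set of endpoints. *)
record ('v, 'e) mgraph =
  verts :: "'v set"
  edges :: "'e set"
  ends :: "'e \<Rightarrow> 'v set"

definition loopfree_multigraph :: "('v, 'e) mgraph \<Rightarrow> bool" where
  "loopfree_multigraph G \<longleftrightarrow> finite (verts G) \<and> finite (edges G) \<and>
     (\<forall>e\<in>edges G. ends G e \<subseteq> verts G \<and> card (ends G e) = 2)"

definition simple_graph :: "('v, 'e) mgraph \<Rightarrow> bool" where
  "simple_graph G \<longleftrightarrow> loopfree_multigraph G \<and> inj_on (ends G) (edges G)"

definition degree :: "('v, 'e) mgraph \<Rightarrow> 'v \<Rightarrow> nat" where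
  "degree G v = card {e \<in> edges G. v \<in> ends G e}"

definition degree_sequence :: "('v, 'e) mgraph \<Rightarrow> int multiset" where
  "degree_sequence G = {# int (degree G v). v \<in># mset_set (verts G) #}"

definition realization :: "('v, 'e) mgraph \<Rightarrow> int list \<Rightarrow> bool" where
  "realization G \<pi> \<longleftrightarrow> simple_graph G \<and> degree_sequence G = mset \<pi>"

(* Every finite simple graph is isomorphic to one with vertices in nat and each edge named
   by its set of endpoints, so fixing these types loses no realization. *)
definition graphic :: "int list \<Rightarrow> bool" where
  "graphic \<pi> \<longleftrightarrow> (\<exists>G :: (nat, nat set) mgraph. realization G \<pi>)"

definition orientation :: "('v, 'e) mgraph \<Rightarrow> ('e \<Rightarrow> 'v) \<Rightarrow> ('e \<Rightarrow> 'v) \<Rightarrow> bool" where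
  "orientation G tail head \<longleftrightarrow> (\<forall>e\<in>edges G. {tail e, head e} = ends G e)"

definition boundary ::
  "('v, 'e) mgraph \<Rightarrow> ('e \<Rightarrow> 'v) \<Rightarrow> ('e \<Rightarrow> 'v) \<Rightarrow> ('e \<Rightarrow> Z3) \<Rightarrow> 'v \<Rightarrow> Z3" where
  "boundary G tail head f v =
     (\<Sum>e | e \<in> edges G \<and> tail e = v. f e) - (\<Sum>e | e \<in> edges G \<and> head e = v. f e)"

definition zero_sum :: "('v, 'e) mgraph \<Rightarrow> ('v \<Rightarrow> Z3) \<Rightarrow> bool" where
  "zero_sum G b \<longleftrightarrow> (\<Sum>v\<in>verts G. b v) = 0"

definition Z3_connected :: "('v, 'e) mgraph \<Rightarrow> bool" where
  "Z3_connected G \<longleftrightarrow> loopfree_multigraph G \<and>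
     (\<forall>b. zero_sum G b \<longrightarrow>
       (\<exists>tail head f. orientation G tail head \<and> (\<forall>e\<in>edges G. f e \<noteq> 0) \<and>
          (\<forall>v\<in>verts G. boundary G tail head f v = b v)))"

definition has_Z3_connected_realization :: "int list \<Rightarrow> bool" where
  "has_Z3_connected_realization \<pi> \<longleftrightarrow>
     (\<exists>G :: (nat, nat set) mgraph. realization G \<pi> \<and> Z3_connected G)"

end

theory Submission
  imports Defs
begin

text \<open>
  Delete a vertex \<open>v\<close> of minimum degree that is joined to vertices of largest degree
  (Kleitman and Wang). If the remaining degree function is realized by a
  \<open>Z\<^sub>3\<close>-connected graph, so is the original one, since a new vertex with at least two
  edges to a \<open>Z\<^sub>3\<close>-connected graph can be absorbed. The induction gets stuck only at a few
  families with very few degrees above 3. These are built from small (multi)graphs by two operations.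
  One adds two adjacent vertices, both joined to the same two old vertices. The other replaces an edge
  \<open>ac\<close> by a path \<open>a x y c\<close> whose new vertices \<open>x\<close>, \<open>y\<close> are also joined to a hub \<open>h\<close>; it preserves
  \<open>Z\<^sub>3\<close>-connectivity provided that the graph stays \<open>Z\<^sub>3\<close>-connected when \<open>ac\<close> is replaced by \<open>ah\<close>,
  and then the new edge \<open>xy\<close> again satisfies the proviso.
\<close>

section \<open>Modulo 3 flows with values \<open>\<plusminus>1\<close>\<close>

text \<open>Deleting a vertex lowers the number \<open>n\<close> of vertices by one and each degree
  by at most one, so the bound \<open>d_1 >= n - 3\<close> passes to the remainder. Two things can
  go wrong. If a chosen neighbour has degree 3, the lower bound on degrees is lost; but the
  neighbours were the largest degrees, so at most two degrees exceed 3. If the remainder is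
  exceptional, the original degrees are those of an exceptional sequence raised by 1 at the
  neighbours, which leaves one or two large degrees and some 4s. These families are governed by the
  deficit between \<open>n\<close> and a large degree. Both growth operations add two vertices of
  degree 3 and raise each growing degree by 2, so they preserve the deficit and the parity of
  \<open>n\<close>; this is why one starting graph per deficit and parity is needed. Joining new
  pairs to two old vertices makes both of these grow, hence the second operation, which lets a
  single hub grow while a 4 or a 5 stays fixed. Its proviso has a simple source: when the demands of
  the two new vertices do not cancel, the surplus leaves through the hub, and the old graph sees the
  path from \<open>a\<close> as an edge \<open>a h\<close> instead of \<open>a c\<close>.\<close>

lemma Z3_exhaust: "(z::Z3) = 0 \<or> z = 1 \<or> z = -1"
proof -
  obtain i where "0 \<le> i" "i < 3" "z = of_int i"
    by (cases z) auto
  then have "i = 0 \<or> i = 1 \<or> i = 2" by auto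
  moreover have "(of_int 2 :: Z3) = -1" by simp
  ultimately show ?thesis using \<open>z = of_int i\<close> by auto
qed

lemma Z3_arith [simp]: "(1::Z3) + 1 = -1" "(-1::Z3) + -1 = 1" "(-1::Z3) - 1 = 1" "(1::Z3) \<noteq> -1" "(-1::Z3) \<noteq> 1"
  "(3::Z3) = 0" "(2::Z3) = -1"
  by simp_all

text \<open>An edge with value -1 is the reversed edge with value 1, so it suffices to orient the
  edges and give all of them the value 1. As \<open>{u, v}\<close> is unordered, \<open>add\<close>
  allows both orientations. Here \<open>b\<close> is the boundary to be attained.\<close>

inductive flow :: "'v set multiset \<Rightarrow> ('v \<Rightarrow> Z3) \<Rightarrow> bool" where
  empty: "flow {#} (\<lambda>_. 0)"
| add: "flow M (\<lambda>z. b z - (of_bool (z = u) - of_bool (z = v))) \<Longrightarrow> u \<noteq> v \<Longrightarrow> flow (add_mset {u, v} M) b"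

text \<open>Rule inversion exposes only the edge that a derivation happened to add last. The
  contributions of different edges commute, so any edge can be taken off first; the sign
  \<open>s\<close> records its orientation relative to \<open>u\<close> and
  \<open>v\<close>.\<close>

lemma flow_remove:
  assumes "flow N b" "{u, v} \<in># N" "u \<noteq> v"
  shows "\<exists>s\<in>{1, -1}. flow (N - {#{u, v}#}) (\<lambda>z. b z - s * (of_bool (z = u) - of_bool (z = v)))"
  using assms
proof (induction rule: flow.induct)
  case empty
  then show ?case by simp
next
  case (add M b u' v')
  show ?case
  proof (cases "{u, v} = {u', v'}")
    case True
    then consider "u = u'" "v = v'" | "u = v'" "v = u'" by (auto simp: doubleton_eq_iff)
    then show ?thesis
    proof cases
      case 1
      then show ?thesis using add by auto
    next
      case 2
      then show ?thesis using add
        by (auto intro!: bexI[of _ "-1"] simp: insert_commute algebra_simps)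
    qed
  next
    case False
    then have "{u, v} \<in># M" using add by auto
    then obtain s where s: "s \<in> {1, -1}"
      "flow (M - {#{u, v}#}) (\<lambda>z. b z - (of_bool (z = u') - of_bool (z = v')) - s * (of_bool (z = u) - of_bool (z = v)))"
      using add by blast
    have "flow (add_mset {u', v'} (M - {#{u, v}#})) (\<lambda>z. b z - s * (of_bool (z = u) - of_bool (z = v)))"
      by (rule flow.add) (use s add in \<open>simp_all add: algebra_simps\<close>)
    then show ?thesis using s False by (auto simp: add_mset_remove_trivial_If)
  qed
qed

lemma flow_addE:
  assumes "flow (add_mset {u, v} M) b" "u \<noteq> v"
  obtains s where "s = 1 \<or> s = -1" "flow M (\<lambda>z. b z - s * (of_bool (z = u) - of_bool (z = v)))"
  using flow_remove[OF assms(1), of u v] assms(2) that[of 1] that[of "-1"] by auto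

lemma flow_addI:
  assumes "flow M (\<lambda>z. b z - s * (of_bool (z = u) - of_bool (z = v)))" "s = 1 \<or> s = -1" "u \<noteq> v"
  shows "flow (add_mset {u, v} M) b"
  using assms(2)
proof
  assume "s = 1"
  then show ?thesis using assms by (intro flow.add) auto
next
  assume "s = -1"
  then have "flow (add_mset {v, u} M) b" using assms by (intro flow.add) (auto simp: algebra_simps)
  then show ?thesis by (simp add: insert_commute)
qed

text \<open>\<open>M\<close> may contain parallel edges, and no edge of \<open>M\<close> is required to lie in \<open>V\<close>.\<close>
definition Z3_conn :: "'v set \<Rightarrow> 'v set multiset \<Rightarrow> bool" where
  "Z3_conn V M \<longleftrightarrow> finite V \<and> (\<forall>b. (\<Sum>v\<in>V. b v) = 0 \<longrightarrow> (\<forall>v. v \<notin> V \<longrightarrow> b v = 0) \<longrightarrow> flow M b)"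

lemma Z3_connI:
  assumes "finite V" "\<And>b. (\<Sum>v\<in>V. b v) = 0 \<Longrightarrow> (\<And>v. v \<notin> V \<Longrightarrow> b v = 0) \<Longrightarrow> flow M b"
  shows "Z3_conn V M"
  using assms unfolding Z3_conn_def by blast

lemma Z3_connD:
  assumes "Z3_conn V M" "(\<Sum>v\<in>V. b v) = 0" "\<And>v. v \<notin> V \<Longrightarrow> b v = 0"
  shows "flow M b"
  using assms unfolding Z3_conn_def by blast

lemma sum_of_bool_eq: "finite V \<Longrightarrow> u \<in> V \<Longrightarrow> (\<Sum>v\<in>V. c * of_bool (v = u)) = (c::Z3)"
  by (simp add: of_bool_def sum.delta if_distrib cong: if_cong)

section \<open>Operations that preserve connectivity over the group of order 3\<close>

lemma Z3_conn_singleton: "Z3_conn {v} {#}"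
proof (rule Z3_connI)
  fix b :: "'a \<Rightarrow> Z3"
  assume "(\<Sum>v\<in>{v}. b v) = 0" "\<And>w. w \<notin> {v} \<Longrightarrow> b w = 0"
  then have "b = (\<lambda>_. 0)" by (auto simp: fun_eq_iff) (metis (full_types))
  then show "flow {#} b" using flow.empty by simp
qed simp

lemma Z3_conn_add_edge:
  assumes "Z3_conn V M" "u \<in> V" "v \<in> V" "u \<noteq> v"
  shows "Z3_conn V (add_mset {u, v} M)"
proof (rule Z3_connI)
  show "finite V" using assms Z3_conn_def by blast
  fix b :: "'a \<Rightarrow> Z3"
  assume b: "(\<Sum>v\<in>V. b v) = 0" "\<And>w. w \<notin> V \<Longrightarrow> b w = 0"
  have "flow M (\<lambda>z. b z - 1 * (of_bool (z = u) - of_bool (z = v)))"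
    by (rule Z3_connD[OF assms(1)])
      (use assms b \<open>finite V\<close> in \<open>auto simp: sum_subtractf sum_of_bool_eq[where c = 1, simplified]\<close>)
  then show "flow (add_mset {u, v} M) b"
    by (rule flow_addI) (use assms in auto)
qed

text \<open>Sums of two values from 1 and -1 cover the whole group: 1 - 1 = 0, -1 - 1 = 1 and 1 + 1
  = -1. So the two edges at \<open>x\<close> meet any demand there, and the old graph balances the
  rest. The case \<open>u = v\<close> of two parallel edges is included and starts the constructions
  of small graphs.\<close>

lemma Z3_conn_absorb:
  assumes "Z3_conn V M" "u \<in> V" "v \<in> V" "x \<notin> V"
  shows "Z3_conn (insert x V) (add_mset {x, u} (add_mset {x, v} M))"
proof (rule Z3_connI)
  have fin: "finite V" using assms Z3_conn_def by blast
  then show "finite (insert x V)" by simp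
  fix b :: "'a \<Rightarrow> Z3"
  assume b: "(\<Sum>v\<in>insert x V. b v) = 0" "\<And>w. w \<notin> insert x V \<Longrightarrow> b w = 0"
  obtain s t :: Z3 where st: "s = 1 \<or> s = -1" "t = 1 \<or> t = -1" "s + t = b x"
  proof -
    consider "b x = 0" | "b x = 1" | "b x = -1" using Z3_exhaust by blast
    then show ?thesis
    proof cases
      case 1 then show ?thesis using that[of 1 "-1"] by simp
    next
      case 2 then show ?thesis using that[of "-1" "-1"] by simp
    next
      case 3 then show ?thesis using that[of "1" "1"] by simp
    qed
  qed
  define c where "c = (\<lambda>z. b z - s * (of_bool (z = x) - of_bool (z = u)) - t * (of_bool (z = x) - of_bool (z = v)))"
  have cx: "c x = 0" using st assms by (auto simp: c_def algebra_simps)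
  have "(\<Sum>v\<in>V. c v) = (\<Sum>z\<in>V. b z + s * of_bool (z = u) + t * of_bool (z = v))"
    by (rule sum.cong) (use assms in \<open>auto simp: c_def\<close>)
  also have "\<dots> = (\<Sum>v\<in>V. b v) + s + t"
    using fin assms by (simp add: sum.distrib sum_of_bool_eq)
  also have "\<dots> = b x + (\<Sum>v\<in>V. b v)" using st by (metis add.assoc add.commute)
  also have "\<dots> = 0" using b fin assms by simp
  finally have "flow M c"
    using cx b assms by (intro Z3_connD[OF assms(1)]) (auto simp: c_def)
  then have "flow (add_mset {x, v} M) (\<lambda>z. b z - s * (of_bool (z = x) - of_bool (z = u)))"
    unfolding c_def by (rule flow_addI) (use assms st in auto)
  then show "flow (add_mset {x, u} (add_mset {x, v} M)) b"
    by (rule flow_addI) (use assms st in auto)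
qed

text \<open>The edge \<open>a h\<close> is subdivided by \<open>x\<close> and its half at
  \<open>h\<close> is doubled. The value found for \<open>a h\<close> in the old graph runs from
  \<open>a\<close> to \<open>x\<close>, and the two parallel edges can pass on any total to
  \<open>h\<close>. This is what keeps the proviso for subdivisions alive.\<close>

lemma Z3_conn_expand:
  assumes "Z3_conn V (add_mset {a, h} M)" "a \<in> V" "h \<in> V" "a \<noteq> h" "x \<notin> V"
  shows "Z3_conn (insert x V) (add_mset {x, a} (add_mset {x, h} (add_mset {x, h} M)))"
proof (rule Z3_connI)
  have fin: "finite V" using assms Z3_conn_def by blast
  then show "finite (insert x V)" by simp
  fix b :: "'a \<Rightarrow> Z3"
  assume b: "(\<Sum>v\<in>insert x V. b v) = 0" "\<And>w. w \<notin> insert x V \<Longrightarrow> b w = 0"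
  \<comment> \<open>The demand of \<open>x\<close> is moved to \<open>h\<close>, where the parallel
    edges will deliver it.\<close>
  define c where "c = (\<lambda>z. if z = x then 0 else b z + b x * of_bool (z = h))"
  have "(\<Sum>z\<in>V. c z) = (\<Sum>z\<in>V. b z + b x * of_bool (z = h))"
    by (rule sum.cong) (use assms in \<open>auto simp: c_def\<close>)
  also have "\<dots> = (\<Sum>v\<in>V. b v) + b x"
    using fin assms by (simp add: sum.distrib sum_of_bool_eq)
  also have "\<dots> = 0" using b fin assms by (simp add: algebra_simps)
  finally have "flow (add_mset {a, h} M) c"
    using b assms by (intro Z3_connD[OF assms(1)]) (auto simp: c_def)
  then obtain p where p: "p = 1 \<or> p = -1" "flow M (\<lambda>z. c z - p * (of_bool (z = a) - of_bool (z = h)))"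
    using assms(4) by (rule flow_addE)
  obtain s t :: Z3 where st: "s = 1 \<or> s = -1" "t = 1 \<or> t = -1" "s + t = b x + p"
  proof -
    consider "b x + p = 0" | "b x + p = 1" | "b x + p = -1" using Z3_exhaust by blast
    then show ?thesis
    proof cases
      case 1 then show ?thesis using that[of 1 "-1"] by simp
    next
      case 2 then show ?thesis using that[of "-1" "-1"] by simp
    next
      case 3 then show ?thesis using that[of "1" "1"] by simp
    qed
  qed
  have t: "t = b x + p - s" using st(3) by (simp add: algebra_simps)
  have eq: "(\<lambda>z. c z - p * (of_bool (z = a) - of_bool (z = h))) =
      (\<lambda>z. b z - (-p) * (of_bool (z = x) - of_bool (z = a)) - s * (of_bool (z = x) - of_bool (z = h))
        - t * (of_bool (z = x) - of_bool (z = h)))"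
    using assms unfolding t by (auto simp: c_def fun_eq_iff algebra_simps)
  have "flow (add_mset {x, h} M) (\<lambda>z. b z - (-p) * (of_bool (z = x) - of_bool (z = a)) - s * (of_bool (z = x) - of_bool (z = h)))"
    by (rule flow_addI[OF p(2)[unfolded eq]]) (use assms st in auto)
  then have "flow (add_mset {x, h} (add_mset {x, h} M)) (\<lambda>z. b z - (-p) * (of_bool (z = x) - of_bool (z = a)))"
    by (rule flow_addI) (use assms st in auto)
  then show "flow (add_mset {x, a} (add_mset {x, h} (add_mset {x, h} M))) b"
    by (rule flow_addI) (use assms p in auto)
qed

text \<open>The values \<open>p\<close>, \<open>q\<close>, \<open>r\<close> run along the path \<open>a\<close>, \<open>x\<close>, \<open>y\<close>, \<open>c\<close>;
  conservation at \<open>x\<close> and \<open>y\<close> then fixes the values on the two edges to the hub \<open>h\<close>.\<close>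
lemma flow_subdivide:
  assumes "flow M (\<lambda>z. if z = x \<or> z = y then 0 else
      b z - p * of_bool (z = a) + r * of_bool (z = c) + (b x + b y + p - r) * of_bool (z = h))"
    and "p \<noteq> 0" "q \<noteq> 0" "r \<noteq> 0" "b x + p - q \<noteq> 0" "b y + q - r \<noteq> 0"
    and "x \<noteq> y" "x \<notin> {a, c, h}" "y \<notin> {a, c, h}"
  shows "flow (add_mset {x, a} (add_mset {x, h} (add_mset {x, y} (add_mset {y, h} (add_mset {y, c} M))))) b"
proof -
  have unit: "z = 1 \<or> z = -1" if "z \<noteq> 0" for z :: Z3
    using Z3_exhaust that by blast
  have "flow (add_mset {y, c} M) (\<lambda>z. b z - (-p) * (of_bool (z = x) - of_bool (z = a))
      - (b x + p - q) * (of_bool (z = x) - of_bool (z = h)) - q * (of_bool (z = x) - of_bool (z = y))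
      - (b y + q - r) * (of_bool (z = y) - of_bool (z = h)))"
    by (rule flow_addI[where s = r], rule back_subst[of "flow M", OF assms(1)])
      (use assms(2-) unit[of r] in \<open>auto simp: fun_eq_iff algebra_simps\<close>)
  then have "flow (add_mset {y, h} (add_mset {y, c} M)) (\<lambda>z. b z - (-p) * (of_bool (z = x) - of_bool (z = a))
      - (b x + p - q) * (of_bool (z = x) - of_bool (z = h)) - q * (of_bool (z = x) - of_bool (z = y)))"
    by (rule flow_addI) (use assms(2-) unit in auto)
  then have "flow (add_mset {x, y} (add_mset {y, h} (add_mset {y, c} M))) (\<lambda>z. b z - (-p) * (of_bool (z = x) - of_bool (z = a))
      - (b x + p - q) * (of_bool (z = x) - of_bool (z = h)))"
    by (rule flow_addI) (use assms(2-) unit in auto)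
  then have "flow (add_mset {x, h} (add_mset {x, y} (add_mset {y, h} (add_mset {y, c} M)))) (\<lambda>z. b z - (-p) * (of_bool (z = x) - of_bool (z = a)))"
    by (rule flow_addI) (use assms(2-) unit in auto)
  then show ?thesis
    by (rule flow_addI) (use assms(2-) unit[of "-p"] in auto)
qed

text \<open>If the demands at \<open>x\<close> and \<open>y\<close> cancel, equal values on the two
  end edges of the path leave nothing for the hub, and the old graph with \<open>a c\<close>
  supplies that value. Otherwise the value \<open>r\<close> at \<open>c\<close> is fixed in advance
  and the surplus is charged to the hub, so that the old graph with \<open>a h\<close> supplies the
  value at \<open>a\<close>.\<close>

lemma Z3_conn_subdivide:
  assumes "Z3_conn V (add_mset {a, c} M)" "Z3_conn V (add_mset {a, h} M)"
    and "a \<in> V" "c \<in> V" "h \<in> V" "a \<noteq> c" "a \<noteq> h" "x \<notin> V" "y \<notin> V" "x \<noteq> y"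
  shows "Z3_conn (insert x (insert y V))
    (add_mset {x, a} (add_mset {x, h} (add_mset {x, y} (add_mset {y, h} (add_mset {y, c} M)))))"
proof (rule Z3_connI)
  have fin: "finite V" using assms Z3_conn_def by blast
  then show "finite (insert x (insert y V))" by simp
  fix b :: "'a \<Rightarrow> Z3"
  assume b: "(\<Sum>v\<in>insert x (insert y V). b v) = 0" "\<And>w. w \<notin> insert x (insert y V) \<Longrightarrow> b w = 0"
  have sum0: "b x + b y + (\<Sum>v\<in>V. b v) = 0"
    using b(1) fin assms by (simp add: add.assoc)
  have new: "x \<notin> {a, c, h}" "y \<notin> {a, c, h}" using assms by auto
  let ?res = "\<lambda>p r z. if z = x \<or> z = y then 0 else
      b z - p * of_bool (z = a) + r * of_bool (z = c) + (b x + b y + p - r) * of_bool (z = h)"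
  show "flow (add_mset {x, a} (add_mset {x, h} (add_mset {x, y} (add_mset {y, h} (add_mset {y, c} M))))) b"
  proof (cases "b x + b y = 0")
    case True
    let ?d = "\<lambda>z. if z = x \<or> z = y then 0 else b z"
    have "(\<Sum>v\<in>V. ?d v) = (\<Sum>v\<in>V. b v)"
      by (rule sum.cong) (use assms in auto)
    then have "flow (add_mset {a, c} M) ?d"
      using sum0 True b by (intro Z3_connD[OF assms(1)]) auto
    then obtain p where p: "p = 1 \<or> p = -1" "flow M (\<lambda>z. ?d z - p * (of_bool (z = a) - of_bool (z = c)))"
      using assms by (elim flow_addE)
    have "(\<lambda>z. ?d z - p * (of_bool (z = a) - of_bool (z = c))) = ?res p p"
      using True new by (auto simp: fun_eq_iff algebra_simps)
    with p have fl: "flow M (?res p p)" by simp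
    have y: "b y = - b x" using True by (simp add: eq_neg_iff_add_eq_0 add.commute)
    \<comment> \<open>With \<open>r = p\<close> and \<open>b y = - b x\<close> the two hub values
      are negatives of each other, so \<open>q\<close> only has to avoid 0 and
      \<open>b x + p\<close>.\<close>
    consider "b x = 0" | "b x \<noteq> 0" by blast
    then show ?thesis
    proof cases
      case 1
      show ?thesis
        by (rule flow_subdivide[OF fl, where q = "-p"]) (use p y 1 new assms(10) in auto)
    next
      case 2
      show ?thesis
        by (rule flow_subdivide[OF fl, where q = "b x"]) (use p y 2 new assms(10) in auto)
    qed
  next
    case False
    \<comment> \<open>The value \<open>r\<close> must be chosen before the flow on the old graph
      reveals \<open>p\<close>, whereas \<open>q\<close> may depend on \<open>p\<close>.\<close>
    have *: ?thesis
      if r: "r \<noteq> 0" and q: "\<And>p. p \<noteq> 0 \<Longrightarrow> q p \<noteq> 0 \<and> b x + p - q p \<noteq> 0 \<and> b y + q p - r \<noteq> 0"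
      for r :: Z3 and q :: "Z3 \<Rightarrow> Z3"
    proof -
      let ?d = "\<lambda>z. if z = x \<or> z = y then 0 else
        b z + r * of_bool (z = c) + (b x + b y - r) * of_bool (z = h)"
      have "(\<Sum>v\<in>V. ?d v) = (\<Sum>z\<in>V. b z + r * of_bool (z = c) + (b x + b y - r) * of_bool (z = h))"
        by (rule sum.cong) (use assms in auto)
      also have "\<dots> = (\<Sum>v\<in>V. b v) + r + (b x + b y - r)"
        using fin assms by (simp only: sum.distrib sum_of_bool_eq)
      also have "\<dots> = 0" using sum0 by (simp add: add.commute)
      finally have "flow (add_mset {a, h} M) ?d"
        using b assms by (intro Z3_connD[OF assms(2)]) auto
      then obtain p where p: "p = 1 \<or> p = -1" "flow M (\<lambda>z. ?d z - p * (of_bool (z = a) - of_bool (z = h)))"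
        using assms by (elim flow_addE)
      have "(\<lambda>z. ?d z - p * (of_bool (z = a) - of_bool (z = h))) = ?res p r"
        using new by (auto simp: fun_eq_iff algebra_simps)
      with p have fl: "flow M (?res p r)" by simp
      show ?thesis
        by (rule flow_subdivide[OF fl, where q = "q p"]) (use p r q[of p] new assms(10) in auto)
    qed
    \<comment> \<open>These are all pairs with nonzero sum. The values chosen for \<open>q\<close>
      and \<open>r\<close> keep both hub values nonzero for either sign of \<open>p\<close>.\<close>
    consider "b x \<noteq> 0" "b y = 0" | "b x = 0" "b y \<noteq> 0" | "b x \<noteq> 0" "b y = b x"
      using False Z3_exhaust[of "b x"] Z3_exhaust[of "b y"] by force
    then show ?thesis
    proof cases
      case 1
      then show ?thesis using Z3_exhaust[of "b x"] by (intro *[of "- b x" "\<lambda>_. b x"]) auto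
    next
      case 2
      then show ?thesis
        by (intro *[of "b y" "\<lambda>p. -p"]) (use Z3_exhaust in force)+
    next
      case 3
      then show ?thesis by (intro *[of "b x" "\<lambda>_. b x"]) auto
    qed
  qed
qed

section \<open>Realizable degree functions\<close>

definition deg :: "'v set multiset \<Rightarrow> 'v \<Rightarrow> nat" where
  "deg M v = size {#e \<in># M. v \<in> e#}"

lemma deg_simps [simp]:
  "deg {#} v = 0"
  "deg (add_mset e M) v = (if v \<in> e then 1 else 0) + deg M v"
  by (simp_all add: deg_def)

lemma deg_union [simp]: "deg (M + N) v = deg M v + deg N v"
  by (simp add: deg_def)

definition simple :: "'v set \<Rightarrow> 'v set multiset \<Rightarrow> bool" where
  "simple V M \<longleftrightarrow> (\<forall>e. count M e \<le> 1) \<and> (\<forall>e\<in>#M. e \<subseteq> V \<and> card e = 2)"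

lemma simple_empty [simp]: "simple V {#}"
  by (simp add: simple_def)

lemma simple_mono: "simple V M \<Longrightarrow> V \<subseteq> W \<Longrightarrow> simple W M"
  by (auto simp: simple_def)

lemma simple_add:
  assumes "simple V M" "{u, v} \<notin># M" "u \<in> V" "v \<in> V" "u \<noteq> v"
  shows "simple V (add_mset {u, v} M)"
  using assms by (auto simp: simple_def count_eq_zero_iff)

lemma simple_fresh: "simple V M \<Longrightarrow> x \<notin> V \<Longrightarrow> x \<in> e \<Longrightarrow> e \<notin># M"
  by (auto simp: simple_def)

lemma deg_fresh: "simple V M \<Longrightarrow> x \<notin> V \<Longrightarrow> deg M x = 0"
  by (auto simp: deg_def simple_def filter_mset_eq_conv)

definition Z3_realizable :: "'v set \<Rightarrow> ('v \<Rightarrow> nat) \<Rightarrow> bool" where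
  "Z3_realizable V d \<longleftrightarrow> (\<exists>M. simple V M \<and> (\<forall>v\<in>V. deg M v = d v) \<and> Z3_conn V M)"

lemma Z3_realizable_cong:
  "Z3_realizable V d \<Longrightarrow> V = W \<Longrightarrow> (\<And>v. v \<in> W \<Longrightarrow> d v = d' v) \<Longrightarrow> Z3_realizable W d'"
  by (auto simp: Z3_realizable_def)

lemma Z3_conn_add_star:
  assumes "Z3_conn V M" "finite T" "T \<subseteq> V" "x \<in> V" "x \<notin> T"
  shows "Z3_conn V (image_mset (\<lambda>t. {x, t}) (mset_set T) + M)"
  using assms(2,3,5)
proof (induction T)
  case empty
  then show ?case using assms by simp
next
  case (insert t T)
  then show ?case using assms Z3_conn_add_edge[of V _ x t] by auto
qed

text \<open>This reverses the deletion of a vertex. Two of the edges at \<open>x\<close> serve to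
  absorb it; the others are then extra edges inside a graph that already has the property.\<close>

lemma Z3_realizable_absorb:
  assumes "Z3_realizable V d" "x \<notin> V" "T \<subseteq> V" "card T \<ge> 2"
  shows "Z3_realizable (insert x V) (\<lambda>v. if v = x then card T else if v \<in> T then d v + 1 else d v)"
proof -
  obtain M where M: "simple V M" "\<forall>v\<in>V. deg M v = d v" "Z3_conn V M"
    using assms(1) by (auto simp: Z3_realizable_def)
  have finT: "finite T" using assms(4) card.infinite by fastforce
  obtain p q where pq: "p \<in> T" "q \<in> T" "p \<noteq> q"
    using assms(4) by (metis card_le_Suc0_iff_eq finT not_less_eq_eq numeral_2_eq_2)
  let ?N = "image_mset (\<lambda>t. {x, t}) (mset_set T)"
  have inj: "inj_on (\<lambda>t. {x, t}) T"
    using assms by (auto simp: inj_on_def doubleton_eq_iff)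
  then have N: "?N = mset_set ((\<lambda>t. {x, t}) ` T)"
    by (rule image_mset_mset_set)
  have T: "mset_set T = add_mset p (add_mset q (mset_set (T - {p, q})))"
  proof -
    have "mset_set T = mset_set (insert p (insert q (T - {p, q})))"
      using pq by (intro arg_cong[of _ _ mset_set]) auto
    then show ?thesis using pq finT by simp
  qed
  have "Z3_conn (insert x V) (add_mset {x, p} (add_mset {x, q} M))"
    using Z3_conn_absorb[OF M(3)] pq assms by auto
  then have "Z3_conn (insert x V) (image_mset (\<lambda>t. {x, t}) (mset_set (T - {p, q})) + (add_mset {x, p} (add_mset {x, q} M)))"
    by (rule Z3_conn_add_star) (use finT assms in auto)
  then have Z3_conn: "Z3_conn (insert x V) (?N + M)"
    by (simp add: T)
  have cnt: "count ?N e \<le> 1" for e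
    unfolding N by (simp add: count_mset_set')
  have simp: "simple (insert x V) (?N + M)"
    unfolding simple_def
  proof safe
    fix e
    show "count (?N + M) e \<le> 1"
    proof (cases "x \<in> e")
      case True
      then have "count M e = 0" using M assms(2) simple_fresh by (metis count_eq_zero_iff)
      then show ?thesis using cnt by simp
    next
      case False
      then have "e \<notin># ?N" by auto
      then have "count ?N e = 0" by (rule not_in_iff[THEN iffD1])
      then show ?thesis using M by (simp add: simple_def)
    qed
  next
    fix e v assume "e \<in># ?N + M" "v \<in> e" "v \<notin> V"
    then show "v = x" using M finT assms by (auto simp: simple_def)
  next
    fix e assume "e \<in># ?N + M"
    moreover have "card {x, t} = 2" if "t \<in> T" for t using that assms(2,3) card_2_iff by blast
    ultimately show "card e = 2" using M finT by (auto simp: simple_def)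
  qed
  have degN: "deg ?N v = (if v = x then card T else of_bool (v \<in> T))" for v
  proof -
    have "deg ?N v = card {e \<in> (\<lambda>t. {x, t}) ` T. v \<in> e}"
      unfolding N deg_def by (simp add: filter_mset_mset_set finT)
    also have "{e \<in> (\<lambda>t. {x, t}) ` T. v \<in> e} = (\<lambda>t. {x, t}) ` {t \<in> T. v = x \<or> v = t}"
      by auto
    also have "card \<dots> = card {t \<in> T. v = x \<or> v = t}"
      using inj by (intro card_image) (auto simp: inj_on_def)
    also have "\<dots> = (if v = x then card T else of_bool (v \<in> T))"
    proof -
      have "{t \<in> T. v = t} = (if v \<in> T then {v} else {})" by auto
      then show ?thesis by auto
    qed
    finally show ?thesis .
  qed
  have "\<forall>v\<in>insert x V. deg (?N + M) v = (if v = x then card T else if v \<in> T then d v + 1 else d v)"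
    using M deg_fresh[OF M(1) assms(2)] assms(2,3) by (auto simp: degN)
  with simp Z3_conn show ?thesis unfolding Z3_realizable_def by blast
qed

section \<open>Adding vertices of degree 3 in adjacent pairs\<close>

lemma even_card_induct [consumes 2, case_names empty insert2]:
  assumes "finite U" "even (card U)" "P {}"
    and "\<And>x y U. finite U \<Longrightarrow> even (card U) \<Longrightarrow> x \<noteq> y \<Longrightarrow> x \<notin> U \<Longrightarrow> y \<notin> U \<Longrightarrow> P U \<Longrightarrow> P (insert x (insert y U))"
  shows "P U"
  using assms(1,2)
proof (induction "card U" arbitrary: U rule: less_induct)
  case less
  show ?case
  proof (cases "U = {}")
    case True
    then show ?thesis using assms by simp
  next
    case False
    then obtain x where x: "x \<in> U" by auto
    have "card (U - {x}) = card U - 1" using x less by simp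
    moreover have "card U > 1" using less False by (metis card_0_eq even_numeral gr0I less_one nat_neq_iff odd_one)
    ultimately have "U - {x} \<noteq> {}" by (metis card.empty diff_is_0_eq not_less)
    then obtain y where y: "y \<in> U" "y \<noteq> x" by auto
    let ?U = "U - {x, y}"
    have U: "U = insert x (insert y ?U)" using x y by auto
    have "card U = card ?U + 2"
    proof -
      have "card (insert x (insert y ?U)) = card ?U + 2" using less y by simp
      then show ?thesis using U by simp
    qed
    then have "P ?U" using less by (intro less(1)) auto
    then show ?thesis using assms(4)[of ?U x y] less y \<open>card U = card ?U + 2\<close> U by auto
  qed
qed

text \<open>Each pair takes two absorptions: \<open>x\<close> enters with degree 2, joined to
  \<open>u\<close> and \<open>w\<close>, and \<open>y\<close>, joined to \<open>u\<close>,
  \<open>w\<close> and \<open>x\<close>, brings \<open>x\<close> to degree 3.\<close>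

lemma Z3_realizable_petals:
  assumes "finite U" "even (card U)" "Z3_realizable V d" "u \<in> V" "w \<in> V" "u \<noteq> w" "U \<inter> V = {}"
  shows "Z3_realizable (V \<union> U) (\<lambda>v. if v = u \<or> v = w then d v + card U else if v \<in> U then 3 else d v)"
  using assms(1,2,7)
proof (induction rule: even_card_induct)
  case empty
  then show ?case using assms(3) by (auto elim: Z3_realizable_cong)
next
  case (insert2 x y U)
  let ?d = "\<lambda>v. if v = u \<or> v = w then d v + card U else if v \<in> U then 3 else d v"
  have 1: "Z3_realizable (V \<union> U) ?d" using insert2 by auto
  have 2: "Z3_realizable (insert x (V \<union> U))
      (\<lambda>v. if v = x then card {u, w} else if v \<in> {u, w} then ?d v + 1 else ?d v)"
    by (rule Z3_realizable_absorb[OF 1]) (use insert2 assms in auto)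
  have xy: "x \<notin> {u, w}" "y \<notin> {u, w}" using insert2 assms by auto
  show ?case
    by (rule Z3_realizable_cong[OF Z3_realizable_absorb[OF 2, of y "{u, w, x}"]])
      (use insert2 assms xy in auto)
qed

text \<open>The edge \<open>{a, c}\<close> that will be subdivided is kept apart from \<open>M\<close>: it may be parallel to an edge
  of \<open>M\<close>, in which case the graph becomes simple only after the first subdivision.\<close>
definition hub_state :: "'v set \<Rightarrow> ('v \<Rightarrow> nat) \<Rightarrow> 'v set multiset \<Rightarrow> 'v \<Rightarrow> 'v \<Rightarrow> 'v \<Rightarrow> bool" where
  "hub_state V d M a c h \<longleftrightarrow> Z3_conn V (add_mset {a, c} M) \<and> Z3_conn V (add_mset {a, h} M) \<and>
     a \<in> V \<and> c \<in> V \<and> h \<in> V \<and> a \<noteq> c \<and> a \<noteq> h \<and> c \<noteq> h \<and> simple V M \<and>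
     (\<forall>v\<in>V. deg (add_mset {a, c} M) v = d v)"

text \<open>With \<open>{x, h}\<close> in place of \<open>{x, y}\<close>, the vertex
  \<open>y\<close> is left with its edges to \<open>h\<close> and \<open>c\<close> and can be
  absorbed; what remains at \<open>x\<close> is one edge to \<open>a\<close> and two to
  \<open>h\<close>, which is \<open>Z3_conn_expand\<close> applied to the old edge
  \<open>a h\<close>. So the proviso for \<open>a c\<close> yields the one for \<open>x y\<close>,
  with the same hub. The edge \<open>x y\<close> joins two new vertices and is therefore never
  parallel to another edge.\<close>

lemma hub_state_step:
  assumes "hub_state V d M a c h" "x \<notin> V" "y \<notin> V" "x \<noteq> y"
  defines "M' \<equiv> add_mset {x, a} (add_mset {x, h} (add_mset {y, h} (add_mset {y, c} M)))"
  shows "hub_state (insert x (insert y V)) (\<lambda>v. if v = h then d v + 2 else if v = x \<or> v = y then 3 else d v) M' x y h"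
    and "{x, y} \<notin># M'"
proof -
  note st = assms(1)[unfolded hub_state_def]
  have ne: "x \<noteq> a" "x \<noteq> c" "x \<noteq> h" "y \<noteq> a" "y \<noteq> c" "y \<noteq> h" using st assms(2-4) by auto
  have fresh: "{x, w} \<notin># M" "{y, w} \<notin># M" for w
    using st assms(2,3) simple_fresh[of V M] by blast+
  show "{x, y} \<notin># M'"
    using fresh[of y] ne assms(4) by (auto simp: M'_def doubleton_eq_iff)
  have 1: "Z3_conn (insert x (insert y V)) (add_mset {x, y} M')"
    using Z3_conn_subdivide[of V a c M h x y] st assms(2-4) by (simp add: M'_def add_mset_commute)
  have "Z3_conn (insert x V) (add_mset {x, a} (add_mset {x, h} (add_mset {x, h} M)))"
    using Z3_conn_expand[of V a h M x] st assms(2) by blast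
  then have "Z3_conn (insert y (insert x V)) (add_mset {y, h} (add_mset {y, c} (add_mset {x, a} (add_mset {x, h} (add_mset {x, h} M)))))"
    by (rule Z3_conn_absorb) (use st assms(2-4) in auto)
  then have 2: "Z3_conn (insert x (insert y V)) (add_mset {x, h} M')"
    by (simp add: M'_def add_mset_commute insert_commute)
  have Msimple: "simple V M" using st by blast
  have 3: "simple (insert x (insert y V)) M'"
    unfolding M'_def
    by (intro simple_add simple_mono[OF Msimple])
      (use st fresh[of a] fresh[of h] fresh[of c] ne assms(2-4) in \<open>auto simp: doubleton_eq_iff\<close>)
  have 4: "\<forall>v\<in>insert x (insert y V). deg (add_mset {x, y} M') v = (if v = h then d v + 2 else if v = x \<or> v = y then 3 else d v)"
    using st ne assms(2-4) deg_fresh[of V M x] deg_fresh[of V M y] by (auto simp: M'_def)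
  show "hub_state (insert x (insert y V)) (\<lambda>v. if v = h then d v + 2 else if v = x \<or> v = y then 3 else d v) M' x y h"
    unfolding hub_state_def using 1 2 3 4 st ne assms(4) by simp
qed

lemma hub_state_imp_realizable:
  assumes "hub_state V d M a c h" "{a, c} \<notin># M"
  shows "Z3_realizable V d"
  unfolding Z3_realizable_def using assms simple_add[of V M a c]
  by (auto simp: hub_state_def)

lemma hub_state_realizable:
  assumes "hub_state V d M a c h" "finite U" "even (card U)" "U \<inter> V = {}" "U = {} \<Longrightarrow> {a, c} \<notin># M"
  shows "Z3_realizable (V \<union> U) (\<lambda>v. if v = h then d v + card U else if v \<in> U then 3 else d v)"
proof (cases "U = {}")
  case True
  then show ?thesis using hub_state_imp_realizable[OF assms(1)] assms(5)
    by (auto elim: Z3_realizable_cong)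
next
  case False
  \<comment> \<open>The induction has to carry the whole state: the distinguished edge moves to the
    newest pair while the hub stays.\<close>
  have "\<exists>M' a' c'. hub_state (V \<union> U) (\<lambda>v. if v = h then d v + card U else if v \<in> U then 3 else d v) M' a' c' h
      \<and> (U = {} \<or> {a', c'} \<notin># M')"
    using assms(2,3,4)
  proof (induction rule: even_card_induct)
    case empty
    then show ?case using assms(1)
      by (intro exI[of _ M] exI[of _ a] exI[of _ c]) (auto simp: hub_state_def)
  next
    case (insert2 x y U)
    let ?d = "\<lambda>v. if v = h then d v + card U else if v \<in> U then 3 else d v"
    obtain M' a' c' where st: "hub_state (V \<union> U) ?d M' a' c' h"
      using insert2 by auto
    have xy: "x \<notin> V \<union> U" "y \<notin> V \<union> U" "h \<in> V"
      using insert2 assms(1) by (auto simp: hub_state_def)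
    let ?M = "add_mset {x, a'} (add_mset {x, h} (add_mset {y, h} (add_mset {y, c'} M')))"
    let ?e = "\<lambda>v. if v = h then d v + card (insert x (insert y U)) else if v \<in> insert x (insert y U) then 3 else d v"
    have "(\<lambda>v. if v = h then ?d v + 2 else if v = x \<or> v = y then 3 else ?d v) = ?e"
      using insert2 xy by (auto simp: fun_eq_iff)
    then have "hub_state (V \<union> insert x (insert y U)) ?e ?M x y h" "{x, y} \<notin># ?M"
      using hub_state_step[OF st xy(1,2) insert2(3)] by simp_all
    then show ?case by blast
  qed
  then obtain M' a' c' where
    "hub_state (V \<union> U) (\<lambda>v. if v = h then d v + card U else if v \<in> U then 3 else d v) M' a' c' h"
    "{a', c'} \<notin># M'" using False by blast
  then show ?thesis by (rule hub_state_imp_realizable)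
qed

section \<open>Small hub states\<close>

lemma Z3_conn_double_edge: "a \<noteq> c \<Longrightarrow> Z3_conn {a, c} {#{a, c}, {a, c}#}"
  using Z3_conn_absorb[OF Z3_conn_singleton[of c], of c c a] by simp

lemma Z3_conn_absorb':
  assumes "Z3_conn V M" "u \<in> V" "v \<in> V" "x \<notin> V" "W = insert x V" "N = add_mset {x, u} (add_mset {x, v} M)"
  shows "Z3_conn W N"
  using Z3_conn_absorb[OF assms(1-4)] assms(5,6) by simp

lemma hub_stateD:
  assumes "hub_state V d M a c h"
  shows "Z3_conn V (add_mset {a, c} M)" "simple V M"
  using assms by (simp_all add: hub_state_def)

text \<open>A degenerate wheel with two spokes, whose rim is the double edge \<open>r1 r2\<close>.
  Subdividing the rim produces the wheels with an even number of spokes.\<close>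

lemma hub_state_wheel:
  assumes "distinct [c, r1, r2]"
  shows "hub_state {c, r1, r2} (\<lambda>v. if v = c then 2 else 3) {#{r1, r2}, {c, r1}, {c, r2}#} r1 r2 c"
proof -
  have "Z3_conn {c, r1, r2} {#{r1, r2}, {r1, r2}, {c, r1}, {c, r2}#}"
    by (rule Z3_conn_absorb'[OF Z3_conn_double_edge[of r1 r2], of r1 r2 c]) (use assms in \<open>auto simp: add_mset_commute\<close>)
  moreover have "Z3_conn {c, r1, r2} {#{r1, c}, {r1, r2}, {c, r1}, {c, r2}#}"
    by (rule Z3_conn_absorb'[OF Z3_conn_double_edge[of c r1], of r1 c r2])
      (use assms in \<open>auto simp: add_mset_commute insert_commute\<close>)
  ultimately show ?thesis
    unfolding hub_state_def using assms
    by (auto intro!: simple_add simp: doubleton_eq_iff)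
qed

lemma Z3_conn_wheel4:
  assumes "distinct [c, r1, r2, r3, r4]"
  shows "Z3_conn {c, r1, r2, r3, r4}
    {#{c, r1}, {c, r2}, {c, r3}, {c, r4}, {r1, r2}, {r2, r3}, {r3, r4}, {r4, r1}#}"
proof -
  have "hub_state {c, r1, r2} (\<lambda>v. if v = c then 2 else 3) {#{r1, r2}, {c, r1}, {c, r2}#} r1 r2 c"
    using assms by (intro hub_state_wheel) auto
  from hub_stateD(1)[OF hub_state_step(1)[OF this, of r4 r3]] show ?thesis
    using assms by (auto simp: add_mset_commute insert_commute)
qed

text \<open>In the names of these states, the parity is that of the number of vertices; then come
  the degree of the hub and the other degrees different from 3. A subdivision adds 2 to the number
  of vertices and to the hub degree, so their difference is 2 here and in
  \<open>hub_state_odd_3_4\<close>, 3 in the next four states, and 1 in the wheels and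
  \<open>hub_state_odd_4_4_4\<close>. Connectivity is mostly checked by absorbing vertices one by
  one into a double edge.\<close>

lemma hub_state_even_2_4:
  assumes "distinct [h, a, c, z]"
  shows "hub_state {h, a, c, z} (\<lambda>v. if v = h then 2 else if v = a then 4 else 3)
    {#{a, c}, {a, z}, {a, h}, {c, z}, {h, z}#} a c h"
proof -
  have "Z3_conn {a, c, z} {#{a, c}, {a, c}, {a, z}, {c, z}#}"
    by (rule Z3_conn_absorb'[OF Z3_conn_double_edge[of a c], of a c z])
      (use assms in \<open>auto simp: add_mset_commute insert_commute\<close>)
  then have 1: "Z3_conn {h, a, c, z} {#{a, c}, {a, c}, {a, z}, {a, h}, {c, z}, {h, z}#}"
    by (rule Z3_conn_absorb'[of _ _ a z h]) (use assms in \<open>auto simp: add_mset_commute insert_commute\<close>)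
  have "Z3_conn {a, h, z} {#{a, h}, {a, h}, {a, z}, {h, z}#}"
    by (rule Z3_conn_absorb'[OF Z3_conn_double_edge[of a h], of a h z])
      (use assms in \<open>auto simp: add_mset_commute insert_commute\<close>)
  then have 2: "Z3_conn {h, a, c, z} {#{a, h}, {a, c}, {a, z}, {a, h}, {c, z}, {h, z}#}"
    by (rule Z3_conn_absorb'[of _ _ a z c]) (use assms in \<open>auto simp: add_mset_commute insert_commute\<close>)
  show ?thesis
    unfolding hub_state_def
    by (intro conjI 1 2 simple_add simple_empty) (use assms in \<open>auto simp: doubleton_eq_iff\<close>)
qed

text \<open>The wheel with centre \<open>c\<close> and rim \<open>h r2 r3 r4\<close> without the
  spoke \<open>c r2\<close>, the hub being a rim vertex. One completion restores that spoke; the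
  other doubles the spoke \<open>c h\<close>.\<close>

lemma hub_state_odd_3_4:
  assumes "distinct [h, c, r2, r3, r4]"
  shows "hub_state {h, c, r2, r3, r4} (\<lambda>v. if v = c then 4 else 3)
    {#{c, h}, {c, r3}, {c, r4}, {h, r2}, {r2, r3}, {r3, r4}, {r4, h}#} c r2 h"
proof -
  have 1: "Z3_conn {h, c, r2, r3, r4} {#{c, r2}, {c, h}, {c, r3}, {c, r4}, {h, r2}, {r2, r3}, {r3, r4}, {r4, h}#}"
    using Z3_conn_wheel4[of c h r2 r3 r4] assms by (auto simp: add_mset_commute insert_commute)
  have "Z3_conn {r4, c, h} {#{c, h}, {c, h}, {c, r4}, {r4, h}#}"
    by (rule Z3_conn_absorb'[OF Z3_conn_double_edge[of c h], of c h r4])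
      (use assms in \<open>auto simp: add_mset_commute insert_commute\<close>)
  then have "Z3_conn {r3, r4, c, h} {#{c, h}, {c, h}, {c, r3}, {c, r4}, {r3, r4}, {r4, h}#}"
    by (rule Z3_conn_absorb'[of _ _ c r4 r3]) (use assms in \<open>auto simp: add_mset_commute insert_commute\<close>)
  then have 2: "Z3_conn {h, c, r2, r3, r4} {#{c, h}, {c, h}, {c, r3}, {c, r4}, {h, r2}, {r2, r3}, {r3, r4}, {r4, h}#}"
    by (rule Z3_conn_absorb'[of _ _ h r3 r2]) (use assms in \<open>auto simp: add_mset_commute insert_commute\<close>)
  show ?thesis
    unfolding hub_state_def
    by (intro conjI 1 2 simple_add simple_empty) (use assms in \<open>auto simp: doubleton_eq_iff\<close>)
qed

text \<open>The wheel with centre \<open>a\<close> and rim \<open>p h q r\<close>, whose spoke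
  \<open>a r\<close> is subdivided by \<open>c\<close>. With \<open>a c\<close> doubled,
  \<open>Z3_conn_expand\<close> applies to that spoke.\<close>

lemma hub_state_even_3_5:
  assumes "distinct [h, a, c, p, q, r]"
  shows "hub_state {h, a, c, p, q, r} (\<lambda>v. if v = a then 5 else 3)
    {#{a, c}, {a, p}, {a, q}, {a, h}, {c, r}, {p, h}, {h, q}, {q, r}, {r, p}#} a c h"
proof -
  have "Z3_conn {a, p, h, q, r} {#{r, a}, {a, p}, {a, q}, {a, h}, {p, h}, {h, q}, {q, r}, {r, p}#}"
    using Z3_conn_wheel4[of a p h q r] assms by (auto simp: add_mset_commute insert_commute)
  from Z3_conn_expand[OF this, of c]
  have 1: "Z3_conn {h, a, c, p, q, r} {#{a, c}, {a, c}, {a, p}, {a, q}, {a, h}, {c, r}, {p, h}, {h, q}, {q, r}, {r, p}#}"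
    using assms by (auto simp: add_mset_commute insert_commute)
  have "Z3_conn {p, a, h} {#{a, h}, {a, h}, {a, p}, {p, h}#}"
    by (rule Z3_conn_absorb'[OF Z3_conn_double_edge[of a h], of a h p])
      (use assms in \<open>auto simp: add_mset_commute insert_commute\<close>)
  then have "Z3_conn {q, p, a, h} {#{a, h}, {a, h}, {a, p}, {a, q}, {p, h}, {h, q}#}"
    by (rule Z3_conn_absorb'[of _ _ a h q]) (use assms in \<open>auto simp: add_mset_commute insert_commute\<close>)
  then have "Z3_conn {r, q, p, a, h} {#{a, h}, {a, h}, {a, p}, {a, q}, {p, h}, {h, q}, {q, r}, {r, p}#}"
    by (rule Z3_conn_absorb'[of _ _ q p r]) (use assms in \<open>auto simp: add_mset_commute insert_commute\<close>)
  then have 2: "Z3_conn {h, a, c, p, q, r} {#{a, h}, {a, c}, {a, p}, {a, q}, {a, h}, {c, r}, {p, h}, {h, q}, {q, r}, {r, p}#}"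
    by (rule Z3_conn_absorb'[of _ _ a r c]) (use assms in \<open>auto simp: add_mset_commute insert_commute\<close>)
  show ?thesis
    unfolding hub_state_def
    by (intro conjI 1 2 simple_add simple_empty) (use assms in \<open>auto simp: doubleton_eq_iff\<close>)
qed

text \<open>One subdivision of \<open>hub_state_odd_3_4\<close> with hub \<open>w\<close> raises
  \<open>w\<close> to degree 5. The role of the hub then passes to the centre \<open>h\<close> of
  degree 4, so the proviso is verified anew for \<open>h\<close>.\<close>

lemma hub_state_odd_4_5:
  assumes "distinct [h, w, r2, r3, r4, x, y]"
  shows "hub_state {h, w, r2, r3, r4, x, y} (\<lambda>v. if v = h then 4 else if v = w then 5 else 3)
    {#{x, h}, {x, w}, {y, w}, {y, r2}, {h, w}, {h, r3}, {h, r4}, {w, r2}, {r2, r3}, {r3, r4}, {r4, w}#} x y h"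
proof -
  let ?M = "{#{x, h}, {x, w}, {y, w}, {y, r2}, {h, w}, {h, r3}, {h, r4}, {w, r2}, {r2, r3}, {r3, r4}, {r4, w}#}"
  have st: "hub_state {w, h, r2, r3, r4} (\<lambda>v. if v = h then 4 else 3)
    {#{h, w}, {h, r3}, {h, r4}, {w, r2}, {r2, r3}, {r3, r4}, {r4, w}#} h r2 w"
    using assms by (intro hub_state_odd_3_4) auto
  have new: "x \<notin> {w, h, r2, r3, r4}" "y \<notin> {w, h, r2, r3, r4}" "x \<noteq> y" using assms by auto
  have "simple {h, w, r2, r3, r4, x, y} ?M \<and> Z3_conn {h, w, r2, r3, r4, x, y} (add_mset {x, y} ?M)"
    using hub_stateD[OF hub_state_step(1)[OF st new]] by (simp add: insert_commute)
  then have 0: "simple {h, w, r2, r3, r4, x, y} ?M" and 1: "Z3_conn {h, w, r2, r3, r4, x, y} (add_mset {x, y} ?M)"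
    by blast+
  have "Z3_conn {w, x, h} {#{x, h}, {x, h}, {x, w}, {h, w}#}"
    by (rule Z3_conn_absorb'[OF Z3_conn_double_edge[of x h], of x h w])
      (use assms in \<open>auto simp: add_mset_commute insert_commute\<close>)
  then have "Z3_conn {r4, w, x, h} {#{x, h}, {x, h}, {x, w}, {h, w}, {h, r4}, {r4, w}#}"
    by (rule Z3_conn_absorb'[of _ _ h w r4]) (use assms in \<open>auto simp: add_mset_commute insert_commute\<close>)
  then have "Z3_conn {r3, r4, w, x, h} {#{x, h}, {x, h}, {x, w}, {h, w}, {h, r3}, {h, r4}, {r3, r4}, {r4, w}#}"
    by (rule Z3_conn_absorb'[of _ _ h r4 r3]) (use assms in \<open>auto simp: add_mset_commute insert_commute\<close>)
  then have "Z3_conn {r2, r3, r4, w, x, h}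
      {#{x, h}, {x, h}, {x, w}, {h, w}, {h, r3}, {h, r4}, {w, r2}, {r2, r3}, {r3, r4}, {r4, w}#}"
    by (rule Z3_conn_absorb'[of _ _ w r3 r2]) (use assms in \<open>auto simp: add_mset_commute insert_commute\<close>)
  then have 2: "Z3_conn {h, w, r2, r3, r4, x, y} (add_mset {x, h} ?M)"
    by (rule Z3_conn_absorb'[of _ _ w r2 y]) (use assms in \<open>auto simp: add_mset_commute insert_commute\<close>)
  show ?thesis
    unfolding hub_state_def by (intro conjI 0 1 2) (use assms in auto)
qed

text \<open>The wheel with centre \<open>a\<close> and rim \<open>h c w z\<close> without the spoke
  \<open>a h\<close>: replacing the distinguished edge by \<open>a h\<close> restores the wheel,
  while the distinguished edge itself doubles the spoke \<open>a c\<close>.\<close>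

lemma hub_state_odd_2_4_4:
  assumes "distinct [h, a, c, w, z]"
  shows "hub_state {h, a, c, w, z} (\<lambda>v. if v = h then 2 else if v = a \<or> v = c then 4 else 3)
    {#{a, c}, {c, h}, {c, w}, {h, z}, {a, w}, {a, z}, {w, z}#} a c h"
proof -
  have "Z3_conn {w, a, c} {#{a, c}, {a, c}, {c, w}, {a, w}#}"
    by (rule Z3_conn_absorb'[OF Z3_conn_double_edge[of a c], of a c w])
      (use assms in \<open>auto simp: add_mset_commute insert_commute\<close>)
  then have "Z3_conn {z, w, a, c} {#{a, c}, {a, c}, {c, w}, {a, w}, {a, z}, {w, z}#}"
    by (rule Z3_conn_absorb'[of _ _ a w z]) (use assms in \<open>auto simp: add_mset_commute insert_commute\<close>)
  then have 1: "Z3_conn {h, a, c, w, z} {#{a, c}, {a, c}, {c, h}, {c, w}, {h, z}, {a, w}, {a, z}, {w, z}#}"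
    by (rule Z3_conn_absorb'[of _ _ c z h]) (use assms in \<open>auto simp: add_mset_commute insert_commute\<close>)
  have 2: "Z3_conn {h, a, c, w, z} {#{a, h}, {a, c}, {c, h}, {c, w}, {h, z}, {a, w}, {a, z}, {w, z}#}"
    using Z3_conn_wheel4[of a h c w z] assms by (auto simp: add_mset_commute insert_commute)
  show ?thesis
    unfolding hub_state_def
    by (intro conjI 1 2 simple_add simple_empty) (use assms in \<open>auto simp: doubleton_eq_iff\<close>)
qed

text \<open>One subdivision of \<open>hub_state_even_2_4\<close> uses up one of the two parallel
  edges \<open>a c\<close>. The copy that is left becomes the distinguished edge, now with hub
  \<open>z\<close>.\<close>

lemma hub_state_even_3_4_4:
  assumes "distinct [z, h, a, c, x, y]"
  shows "hub_state {z, h, a, c, x, y} (\<lambda>v. if v = a \<or> v = h then 4 else 3)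
    {#{a, z}, {a, h}, {c, z}, {h, z}, {x, a}, {x, h}, {x, y}, {y, h}, {y, c}#} a c z"
proof -
  let ?M = "{#{a, z}, {a, h}, {c, z}, {h, z}, {x, a}, {x, h}, {x, y}, {y, h}, {y, c}#}"
  have st: "hub_state {h, a, c, z} (\<lambda>v. if v = h then 2 else if v = a then 4 else 3)
    {#{a, c}, {a, z}, {a, h}, {c, z}, {h, z}#} a c h"
    using assms by (intro hub_state_even_2_4) auto
  have new: "x \<notin> {h, a, c, z}" "y \<notin> {h, a, c, z}" "x \<noteq> y" using assms by auto
  have 1: "Z3_conn {z, h, a, c, x, y} (add_mset {a, c} ?M)"
    using hub_stateD(1)[OF hub_state_step(1)[OF st new]]
    by (simp add: insert_commute add_mset_commute)
  have "Z3_conn {h, a, z} {#{a, z}, {a, z}, {a, h}, {h, z}#}"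
    by (rule Z3_conn_absorb'[OF Z3_conn_double_edge[of a z], of a z h])
      (use assms in \<open>auto simp: add_mset_commute insert_commute\<close>)
  then have "Z3_conn {x, h, a, z} {#{a, z}, {a, z}, {a, h}, {h, z}, {x, a}, {x, h}#}"
    by (rule Z3_conn_absorb'[of _ _ a h x]) (use assms in \<open>auto simp: add_mset_commute insert_commute\<close>)
  then have "Z3_conn {y, x, h, a, z} {#{a, z}, {a, z}, {a, h}, {h, z}, {x, a}, {x, h}, {x, y}, {y, h}#}"
    by (rule Z3_conn_absorb'[of _ _ x h y]) (use assms in \<open>auto simp: add_mset_commute insert_commute\<close>)
  then have 2: "Z3_conn {z, h, a, c, x, y} (add_mset {a, z} ?M)"
    by (rule Z3_conn_absorb'[of _ _ z y c]) (use assms in \<open>auto simp: add_mset_commute insert_commute\<close>)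
  show ?thesis
    unfolding hub_state_def
    by (intro conjI 1 2 simple_add simple_empty) (use assms in \<open>auto simp: doubleton_eq_iff\<close>)
qed

text \<open>The wheel with centre and hub \<open>c\<close> gets the rim diagonal
  \<open>r1 r3\<close>; the distinguished edge is the rim edge \<open>r1 r2\<close>.\<close>

lemma hub_state_odd_4_4_4:
  assumes "distinct [c, r1, r2, r3, r4]"
  shows "hub_state {c, r1, r2, r3, r4} (\<lambda>v. if v = c \<or> v = r1 \<or> v = r3 then 4 else 3)
    {#{c, r1}, {c, r2}, {c, r3}, {c, r4}, {r2, r3}, {r3, r4}, {r4, r1}, {r1, r3}#} r1 r2 c"
proof -
  have "Z3_conn {c, r1, r2, r3, r4} (add_mset {r1, r3}
      {#{c, r1}, {c, r2}, {c, r3}, {c, r4}, {r1, r2}, {r2, r3}, {r3, r4}, {r4, r1}#})"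
    using assms by (intro Z3_conn_add_edge Z3_conn_wheel4) auto
  then have 1: "Z3_conn {c, r1, r2, r3, r4}
      {#{r1, r2}, {c, r1}, {c, r2}, {c, r3}, {c, r4}, {r2, r3}, {r3, r4}, {r4, r1}, {r1, r3}#}"
    by (simp add: add_mset_commute)
  have "Z3_conn {r3, r1, c} {#{r1, c}, {c, r1}, {c, r3}, {r1, r3}#}"
    by (rule Z3_conn_absorb'[OF Z3_conn_double_edge[of r1 c], of r1 c r3])
      (use assms in \<open>auto simp: add_mset_commute insert_commute\<close>)
  then have "Z3_conn {r2, r3, r1, c} {#{r1, c}, {c, r1}, {c, r2}, {c, r3}, {r2, r3}, {r1, r3}#}"
    by (rule Z3_conn_absorb'[of _ _ c r3 r2]) (use assms in \<open>auto simp: add_mset_commute insert_commute\<close>)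
  then have "Z3_conn {r4, r2, r3, r1, c} {#{r1, c}, {c, r1}, {c, r2}, {c, r3}, {c, r4}, {r2, r3}, {r3, r4}, {r1, r3}#}"
    by (rule Z3_conn_absorb'[of _ _ c r3 r4]) (use assms in \<open>auto simp: add_mset_commute insert_commute\<close>)
  then have "Z3_conn {r4, r2, r3, r1, c} (add_mset {r4, r1} {#{r1, c}, {c, r1}, {c, r2}, {c, r3}, {c, r4}, {r2, r3}, {r3, r4}, {r1, r3}#})"
    by (rule Z3_conn_add_edge) (use assms in auto)
  then have 2: "Z3_conn {c, r1, r2, r3, r4}
      {#{r1, c}, {c, r1}, {c, r2}, {c, r3}, {c, r4}, {r2, r3}, {r3, r4}, {r4, r1}, {r1, r3}#}"
    by (simp add: add_mset_commute insert_commute)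
  show ?thesis
    unfolding hub_state_def
    by (intro conjI 1 2 simple_add simple_empty) (use assms in \<open>auto simp: doubleton_eq_iff\<close>)
qed

lemma ex_distinct_list:
  assumes "k \<le> card X"
  shows "\<exists>xs. distinct xs \<and> length xs = k \<and> set xs \<subseteq> X"
proof -
  obtain T where "T \<subseteq> X" "card T = k" "finite T"
    using assms obtain_subset_with_card_n by metis
  then show ?thesis
    by (metis distinct_card finite_distinct_list)
qed

text \<open>The wheel with four spokes and both diagonals of its rim. It is treated apart because
  deleting a vertex leaves the complete graph on four vertices, whose degrees are
  exceptional.\<close>

lemma Z3_realizable_K5:
  assumes "card V = 5" "\<And>v. v \<in> V \<Longrightarrow> d v = 4"
  shows "Z3_realizable V d"
proof -
  obtain c r1 r2 r3 r4 where V: "V = {c, r1, r2, r3, r4}" "distinct [c, r1, r2, r3, r4]"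
  proof -
    obtain xs where xs: "distinct xs" "length xs = 5" "set xs \<subseteq> V"
      using ex_distinct_list[of 5 V] assms(1) by auto
    then have "set xs = V"
      using assms(1) by (intro card_subset_eq) (auto simp: distinct_card intro: card_ge_0_finite)
    then show ?thesis using xs that by (auto simp: length_Suc_conv eval_nat_numeral)
  qed
  let ?W = "{#{c, r1}, {c, r2}, {c, r3}, {c, r4}, {r1, r2}, {r2, r3}, {r3, r4}, {r4, r1}#}"
  have "Z3_conn V (add_mset {r1, r3} (add_mset {r2, r4} ?W))"
    unfolding V(1) using V(2) by (intro Z3_conn_add_edge Z3_conn_wheel4) auto
  moreover have "simple V (add_mset {r1, r3} (add_mset {r2, r4} ?W))"
    unfolding V(1) using V(2) by (auto intro!: simple_add simp: doubleton_eq_iff)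
  moreover have "\<forall>v\<in>V. deg (add_mset {r1, r3} (add_mset {r2, r4} ?W)) v = d v"
    using V assms(2) by auto
  ultimately show ?thesis unfolding Z3_realizable_def by blast
qed

section \<open>Infinite families of tight degree functions\<close>

lemma hub_state_family:
  assumes "hub_state V0 d0 M a c h" "V0 \<subseteq> V" "finite V" "even (card V - card V0)"
    and "V0 = V \<Longrightarrow> {a, c} \<notin># M" "d h = d0 h + (card V - card V0)"
    and "\<And>v. v \<in> V0 \<Longrightarrow> v \<noteq> h \<Longrightarrow> d v = d0 v" "\<And>v. v \<in> V - V0 \<Longrightarrow> d v = 3"
  shows "Z3_realizable V d"
proof -
  have h: "h \<in> V0" using assms(1) by (simp add: hub_state_def)
  have fin0: "finite V0" using assms finite_subset by blast
  have card: "card (V - V0) = card V - card V0"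
    using assms fin0 by (simp add: card_Diff_subset)
  have "V - V0 = {} \<Longrightarrow> {a, c} \<notin># M" using assms by blast
  with assms card have "Z3_realizable (V0 \<union> (V - V0))
      (\<lambda>v. if v = h then d0 v + card (V - V0) else if v \<in> V - V0 then 3 else d0 v)"
    by (intro hub_state_realizable) auto
  then show ?thesis
    by (rule Z3_realizable_cong) (use assms h card in auto)
qed

lemma petals_family:
  assumes "Z3_realizable V0 d0" "V0 \<subseteq> V" "finite V" "even (card V - card V0)"
    and "u \<in> V0" "w \<in> V0" "u \<noteq> w"
    and "d u = d0 u + (card V - card V0)" "d w = d0 w + (card V - card V0)"
    and "\<And>v. v \<in> V0 \<Longrightarrow> v \<noteq> u \<Longrightarrow> v \<noteq> w \<Longrightarrow> d v = d0 v" "\<And>v. v \<in> V - V0 \<Longrightarrow> d v = 3"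
  shows "Z3_realizable V d"
proof -
  have fin0: "finite V0" using assms finite_subset by blast
  have card: "card (V - V0) = card V - card V0"
    using assms fin0 by (simp add: card_Diff_subset)
  with assms have "Z3_realizable (V0 \<union> (V - V0))
      (\<lambda>v. if v = u \<or> v = w then d0 v + card (V - V0) else if v \<in> V - V0 then 3 else d0 v)"
    by (intro Z3_realizable_petals) auto
  then show ?thesis
    by (rule Z3_realizable_cong) (use assms card in auto)
qed

lemma card_minus_pair:
  assumes "finite V" "u \<in> V" "w \<in> V" "u \<noteq> w"
  shows "card (V - {u, w}) = card V - 2"
  using assms by (simp add: card_Diff_subset)

lemma realizable_wheel:
  assumes "odd (card V)" "card V \<ge> 5" "u \<in> V" "d u = card V - 1" "\<And>v. v \<in> V \<Longrightarrow> v \<noteq> u \<Longrightarrow> d v = 3"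
  shows "Z3_realizable V d"
proof -
  have fin: "finite V" using assms(2) card.infinite by fastforce
  have "2 \<le> card (V - {u})" using assms fin by simp
  from ex_distinct_list[OF this] obtain r1 r2 where r: "distinct [r1, r2]" "{r1, r2} \<subseteq> V - {u}"
    by (auto simp: length_Suc_conv eval_nat_numeral)
  have c: "card {u, r1, r2} = 3" using r by auto
  show ?thesis
    by (rule hub_state_family[OF hub_state_wheel[of u r1 r2]]) (use assms fin r c in auto)
qed

lemma realizable_n2_4:
  assumes "card V \<ge> 6" "u \<in> V" "w \<in> V" "u \<noteq> w" "d u = card V - 2" "d w = 4"
    and "\<And>v. v \<in> V \<Longrightarrow> v \<noteq> u \<Longrightarrow> v \<noteq> w \<Longrightarrow> d v = 3"
  shows "Z3_realizable V d"
proof -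
  have fin: "finite V" using assms(1) card.infinite by fastforce
  note cp = card_minus_pair[OF fin assms(2-4)]
  show ?thesis
  proof (cases "even (card V)")
    case True
    have "2 \<le> card (V - {u, w})" using assms cp by simp
    from ex_distinct_list[OF this] obtain r1 r2 where r: "distinct [r1, r2]" "{r1, r2} \<subseteq> V - {u, w}"
      by (auto simp: length_Suc_conv eval_nat_numeral)
    have c: "card {u, w, r1, r2} = 4" using r assms by auto
    show ?thesis
      by (rule hub_state_family[OF hub_state_even_2_4[of u w r1 r2]]) (use assms fin r c True in auto)
  next
    case False
    have "3 \<le> card (V - {u, w})" using assms cp by simp
    from ex_distinct_list[OF this] obtain r1 r2 r3 where r: "distinct [r1, r2, r3]" "{r1, r2, r3} \<subseteq> V - {u, w}"
      by (auto simp: length_Suc_conv eval_nat_numeral)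
    have c: "card {u, w, r1, r2, r3} = 5" using r assms by auto
    show ?thesis
      by (rule hub_state_family[OF hub_state_odd_3_4[of u w r1 r2 r3]]) (use assms fin r c False in auto)
  qed
qed

lemma realizable_n3_5:
  assumes "card V \<ge> 8" "u \<in> V" "w \<in> V" "u \<noteq> w" "d u = card V - 3" "d w = 5"
    and "\<And>v. v \<in> V \<Longrightarrow> v \<noteq> u \<Longrightarrow> v \<noteq> w \<Longrightarrow> d v = 3"
  shows "Z3_realizable V d"
proof -
  have fin: "finite V" using assms(1) card.infinite by fastforce
  note cp = card_minus_pair[OF fin assms(2-4)]
  show ?thesis
  proof (cases "even (card V)")
    case True
    have "4 \<le> card (V - {u, w})" using assms cp by simp
    from ex_distinct_list[OF this] obtain r1 r2 r3 r4 where r: "distinct [r1, r2, r3, r4]" "{r1, r2, r3, r4} \<subseteq> V - {u, w}"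
      by (auto simp: length_Suc_conv eval_nat_numeral)
    have c: "card {u, w, r1, r2, r3, r4} = 6" using r assms by auto
    show ?thesis
      by (rule hub_state_family[OF hub_state_even_3_5[of u w r1 r2 r3 r4]]) (use assms fin r c True in auto)
  next
    case False
    have "5 \<le> card (V - {u, w})" using assms cp by simp
    from ex_distinct_list[OF this] obtain r1 r2 r3 r4 r5
      where r: "distinct [r1, r2, r3, r4, r5]" "{r1, r2, r3, r4, r5} \<subseteq> V - {u, w}"
      by (auto simp: length_Suc_conv eval_nat_numeral)
    have c: "card {u, w, r1, r2, r3, r4, r5} = 7" using r assms by auto
    have ne: "{u, w, r1, r2, r3, r4, r5} \<noteq> V" using c assms(1) by auto
    show ?thesis
      by (rule hub_state_family[OF hub_state_odd_4_5[of u w r1 r2 r3 r4 r5]])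
        (use assms(2-7) assms(1) fin r c False ne in auto)
  qed
qed

lemma realizable_n3_4_4:
  assumes "card V \<ge> 7" "distinct [u, p, q]" "{u, p, q} \<subseteq> V" "d u = card V - 3" "d p = 4" "d q = 4"
    and "\<And>v. v \<in> V - {u, p, q} \<Longrightarrow> d v = 3"
  shows "Z3_realizable V d"
proof -
  have fin: "finite V" using assms(1) card.infinite by fastforce
  have cp: "card (V - {u, p, q}) = card V - 3" using assms fin by (simp add: card_Diff_subset)
  show ?thesis
  proof (cases "even (card V)")
    case True
    have "3 \<le> card (V - {u, p, q})" using assms cp by simp
    from ex_distinct_list[OF this] obtain r1 r2 r3 where r: "distinct [r1, r2, r3]" "{r1, r2, r3} \<subseteq> V - {u, p, q}"
      by (auto simp: length_Suc_conv eval_nat_numeral)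
    have c: "card {u, p, q, r1, r2, r3} = 6" using r assms by auto
    show ?thesis
      by (rule hub_state_family[OF hub_state_even_3_4_4[of u p q r1 r2 r3]]) (use assms fin r c True in auto)
  next
    case False
    have "2 \<le> card (V - {u, p, q})" using assms cp by simp
    from ex_distinct_list[OF this] obtain r1 r2 where r: "distinct [r1, r2]" "{r1, r2} \<subseteq> V - {u, p, q}"
      by (auto simp: length_Suc_conv eval_nat_numeral)
    have c: "card {u, p, q, r1, r2} = 5" using r assms by auto
    show ?thesis
      by (rule hub_state_family[OF hub_state_odd_2_4_4[of u p q r1 r2]]) (use assms fin r c False in auto)
  qed
qed

lemma realizable_n1_4_4:
  assumes "odd (card V)" "card V \<ge> 5" "distinct [u, p, q]" "{u, p, q} \<subseteq> V" "d u = card V - 1" "d p = 4" "d q = 4"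
    and "\<And>v. v \<in> V - {u, p, q} \<Longrightarrow> d v = 3"
  shows "Z3_realizable V d"
proof -
  have fin: "finite V" using assms(2) card.infinite by fastforce
  have cp: "card (V - {u, p, q}) = card V - 3" using assms fin by (simp add: card_Diff_subset)
  have "2 \<le> card (V - {u, p, q})" using assms cp by simp
  from ex_distinct_list[OF this] obtain r1 r2 where r: "distinct [r1, r2]" "{r1, r2} \<subseteq> V - {u, p, q}"
    by (auto simp: length_Suc_conv eval_nat_numeral)
  have c: "card {u, p, r1, q, r2} = 5" using r assms by auto
  show ?thesis
    by (rule hub_state_family[OF hub_state_odd_4_4_4[of u p r1 q r2]])
      (use assms fin r c in \<open>auto simp: doubleton_eq_iff\<close>)
qed

text \<open>On five vertices this is the degree sequence 4, 4, 4, 3, 3, which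
  \<open>realizable_n1_4_4\<close> covers. Pairs joined to \<open>u\<close> and \<open>w\<close>
  then raise both large degrees together.\<close>

lemma realizable_n1_n1_4:
  assumes "odd (card V)" "card V \<ge> 5" "distinct [u, w, z]" "{u, w, z} \<subseteq> V"
    and "d u = card V - 1" "d w = card V - 1" "d z = 4" "\<And>v. v \<in> V - {u, w, z} \<Longrightarrow> d v = 3"
  shows "Z3_realizable V d"
proof -
  have fin: "finite V" using assms(2) card.infinite by fastforce
  have cp: "card (V - {u, w, z}) = card V - 3" using assms fin by (simp add: card_Diff_subset)
  have "2 \<le> card (V - {u, w, z})" using assms cp by simp
  from ex_distinct_list[OF this] obtain r1 r2 where r: "distinct [r1, r2]" "{r1, r2} \<subseteq> V - {u, w, z}"
    by (auto simp: length_Suc_conv eval_nat_numeral)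
  have c: "card {u, w, z, r1, r2} = 5" using r assms by auto
  let ?d = "\<lambda>v. if v \<in> {u, w, z} then 4 else 3 :: nat"
  have "Z3_realizable {u, w, z, r1, r2} ?d"
    by (rule realizable_n1_4_4[of _ u w z]) (use assms(3) c in auto)
  then show ?thesis
    by (rule petals_family[where u = u and w = w]) (use assms r c fin in auto)
qed

text \<open>Remove three vertices of degree 3, realize a wheel-like graph with hub \<open>u\<close>
  on the odd number of vertices left, and attach a 4-cycle \<open>w x y z\<close> through
  \<open>w\<close> whose vertices are all joined to \<open>u\<close>. The vertex \<open>w\<close>
  thus has degree 3 + 2. Adding \<open>x\<close>, \<open>y\<close>, \<open>z\<close> in this order
  makes each one absorbable when it enters.\<close>

lemma realizable_n1_5:
  assumes "even (card V)" "card V \<ge> 8" "u \<in> V" "w \<in> V" "u \<noteq> w" "d u = card V - 1" "d w = 5"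
    and "\<And>v. v \<in> V \<Longrightarrow> v \<noteq> u \<Longrightarrow> v \<noteq> w \<Longrightarrow> d v = 3"
  shows "Z3_realizable V d"
proof -
  have fin: "finite V" using assms(2) card.infinite by fastforce
  note cp = card_minus_pair[OF fin assms(3-5)]
  have "3 \<le> card (V - {u, w})" using assms cp by simp
  from ex_distinct_list[OF this] obtain x y z where r: "distinct [x, y, z]" "{x, y, z} \<subseteq> V - {u, w}"
    by (auto simp: length_Suc_conv eval_nat_numeral)
  let ?V = "V - {x, y, z}"
  have "card {x, y, z} = 3" using r by auto
  then have c: "card ?V = card V - 3" using r fin by (subst card_Diff_subset) auto
  have "Z3_realizable ?V (\<lambda>v. if v = u then card V - 4 else 3)"
    by (rule realizable_wheel[of _ u]) (use assms r c in auto)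
  from Z3_realizable_absorb[OF this, of x "{w, u}"]
  have "Z3_realizable (insert x ?V) (\<lambda>v. if v = u then card V - 3 else if v = w then 4 else if v = x then 2 else 3)"
    by (rule Z3_realizable_cong) (use assms r in auto)
  from Z3_realizable_absorb[OF this, of y "{x, u}"]
  have "Z3_realizable (insert y (insert x ?V)) (\<lambda>v. if v = u then card V - 2 else if v = w then 4 else if v = y then 2 else 3)"
    by (rule Z3_realizable_cong) (use assms r in auto)
  from Z3_realizable_absorb[OF this, of z "{y, u, w}"]
  show ?thesis
    by (rule Z3_realizable_cong) (use assms r in auto)
qed

text \<open>Taking off pairs joined to \<open>u\<close> and \<open>w\<close> lowers
  \<open>d u\<close>, \<open>d w\<close> and \<open>card V\<close> by the same even number, so the
  deficit of \<open>u\<close> is unchanged and only \<open>d w\<close> has to be brought down to the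
  least value that its parity and the exceptions permit. Parity makes \<open>d w\<close> even
  exactly when \<open>d u = card V - 2\<close>, which gives 4. Otherwise it is odd: 3 if
  \<open>d u = card V - 1\<close> and \<open>card V\<close> is odd, and 5 in the two cases where 3
  is exceptional.\<close>

lemma realizable_two_large:
  assumes "u \<in> V" "w \<in> V" "u \<noteq> w" "\<And>v. v \<in> V \<Longrightarrow> v \<noteq> u \<Longrightarrow> v \<noteq> w \<Longrightarrow> d v = 3"
    and "card V - 3 \<le> d u" "d u \<le> card V - 1" "3 \<le> d w" "d w \<le> d u" "even (card V + d u + d w)"
    and "\<not> (d u = card V - 3 \<and> d w = 3)" "\<not> (even (card V) \<and> d u = card V - 1 \<and> (d w = 3 \<or> d w = card V - 1))"
  shows "Z3_realizable V d"
proof -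
  have fin: "finite V"
    using assms(6-8) by (intro card_ge_0_finite) linarith
  note cp = card_minus_pair[OF fin assms(1-3)]
  \<comment> \<open>\<open>e\<close> is the value at which the descent of \<open>d w\<close> stops;
    the removed set \<open>U\<close> has \<open>d w - e\<close> vertices of degree 3.\<close>
  have step: ?thesis
    if base: "\<And>V' d'. V' \<subseteq> V \<Longrightarrow> u \<in> V' \<Longrightarrow> w \<in> V' \<Longrightarrow> card V' = card V - (d w - e) \<Longrightarrow> d' w = e \<Longrightarrow>
        d' u = d u - (d w - e) \<Longrightarrow> (\<And>v. v \<in> V' \<Longrightarrow> v \<noteq> u \<Longrightarrow> v \<noteq> w \<Longrightarrow> d' v = 3) \<Longrightarrow> Z3_realizable V' d'"
      and e: "e \<le> d w" "even (d w - e)" "e \<ge> 1" for e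
  proof -
    have "d w - e \<le> card (V - {u, w})" using cp e assms by linarith
    then obtain U where U: "U \<subseteq> V - {u, w}" "card U = d w - e" "finite U"
      using obtain_subset_with_card_n by metis
    have c: "card (V - U) = card V - (d w - e)" using U fin by (simp add: card_Diff_subset subset_Diff_insert)
    have le: "d w - e \<le> card V" using \<open>d w - e \<le> card (V - {u, w})\<close> cp by linarith
    have "Z3_realizable (V - U) (\<lambda>v. if v = u then d u - (d w - e) else if v = w then e else 3)"
      by (rule base) (use U assms c in auto)
    then show ?thesis
      by (rule petals_family[where u = u and w = w]) (use U c le e fin assms in auto)
  qed
  consider "d u = card V - 1" "odd (card V)" | "d u = card V - 1" "even (card V)"
    | "d u = card V - 2" "d u \<noteq> card V - 1" | "d u = card V - 3" "d u \<noteq> card V - 1" "d u \<noteq> card V - 2"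
    using assms(5,6) by linarith
  then show ?thesis
  proof cases
    case 1
    show ?thesis
    proof (rule step[where e = 3])
      fix V' d' assume "V' \<subseteq> V" "u \<in> V'" "w \<in> V'" "card V' = card V - (d w - 3)" "d' w = 3"
        "d' u = d u - (d w - 3)" "\<And>v. v \<in> V' \<Longrightarrow> v \<noteq> u \<Longrightarrow> v \<noteq> w \<Longrightarrow> d' v = 3"
      moreover have "odd (d w)" "d w + 2 \<le> card V" using 1 assms by presburger+
      moreover have "odd (card V - (d w - 3))" using calculation 1 assms by presburger
      ultimately show "Z3_realizable V' d'"
        using 1 assms by (intro realizable_wheel[of V' u d']) auto
    qed (use 1 assms in presburger)+
  next
    case 2
    have 5: "odd (d w)" "5 \<le> d w" "d w + 3 \<le> card V" using 2 assms by presburger+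
    show ?thesis
    proof (rule step[where e = 5])
      fix V' d' assume "V' \<subseteq> V" "u \<in> V'" "w \<in> V'" "card V' = card V - (d w - 5)" "d' w = 5"
        "d' u = d u - (d w - 5)" "\<And>v. v \<in> V' \<Longrightarrow> v \<noteq> u \<Longrightarrow> v \<noteq> w \<Longrightarrow> d' v = 3"
      moreover have "even (card V - (d w - 5))" using 2 5 by presburger
      ultimately show "Z3_realizable V' d'"
        using 2 5 assms(3) by (intro realizable_n1_5[of V' u w d']) auto
    qed (use 2 5 in presburger)+
  next
    case 3
    have 5: "even (d w)" "4 \<le> d w" "d w + 2 \<le> card V" using 3 assms by presburger+
    show ?thesis
    proof (rule step[where e = 4])
      fix V' d' assume "V' \<subseteq> V" "u \<in> V'" "w \<in> V'" "card V' = card V - (d w - 4)" "d' w = 4"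
        "d' u = d u - (d w - 4)" "\<And>v. v \<in> V' \<Longrightarrow> v \<noteq> u \<Longrightarrow> v \<noteq> w \<Longrightarrow> d' v = 3"
      then show "Z3_realizable V' d'"
        using 3 5 assms(3) by (intro realizable_n2_4[of V' u w d']) auto
    qed (use 3 5 in presburger)+
  next
    case 4
    have 5: "odd (d w)" "5 \<le> d w" "d w + 3 \<le> card V" using 4 assms by presburger+
    show ?thesis
    proof (rule step[where e = 5])
      fix V' d' assume "V' \<subseteq> V" "u \<in> V'" "w \<in> V'" "card V' = card V - (d w - 5)" "d' w = 5"
        "d' u = d u - (d w - 5)" "\<And>v. v \<in> V' \<Longrightarrow> v \<noteq> u \<Longrightarrow> v \<noteq> w \<Longrightarrow> d' v = 3"
      then show "Z3_realizable V' d'"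
        using 4 5 assms(3) by (intro realizable_n3_5[of V' u w d']) auto
    qed (use 4 5 in presburger)+
  qed
qed

section \<open>Deleting a vertex of minimum degree\<close>

text \<open>The given realization serves only to show that degrees stay graphic under deletion. With
  neighbourhoods as a function, an exchange of two edges is an update at four vertices.\<close>

definition nbhd_graph :: "'v set \<Rightarrow> ('v \<Rightarrow> nat) \<Rightarrow> ('v \<Rightarrow> 'v set) \<Rightarrow> bool" where
  "nbhd_graph V d N \<longleftrightarrow> finite V \<and> (\<forall>v\<in>V. N v \<subseteq> V - {v} \<and> card (N v) = d v) \<and>
     (\<forall>u\<in>V. \<forall>v\<in>V. u \<in> N v \<longleftrightarrow> v \<in> N u)"

lemma nbhd_graph_delete:
  assumes "nbhd_graph V d N" "v \<in> V"
  shows "nbhd_graph (V - {v}) (\<lambda>x. d x - of_bool (x \<in> N v)) (\<lambda>x. N x - {v})"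
proof -
  have "card (N x - {v}) = d x - of_bool (x \<in> N v)" if "x \<in> V" for x
    using assms that by (auto simp: nbhd_graph_def card_Diff_singleton_if)
  then show ?thesis using assms by (auto simp: nbhd_graph_def)
qed

lemma nbhd_graph_degree_less:
  assumes "nbhd_graph V d N" "v \<in> V"
  shows "d v < card V"
proof -
  have "N v \<subseteq> V - {v}" "finite V" "card (N v) = d v" using assms by (auto simp: nbhd_graph_def)
  then have "d v \<le> card (V - {v})" by (metis card_mono finite_Diff)
  then show ?thesis using assms(2) \<open>finite V\<close> by (metis card_Diff1_less le_less_trans)
qed

text \<open>A deleted vertex takes its own degree out of the sum and 1 from each neighbour, twice
  its degree in all.\<close>

lemma nbhd_graph_even_sum:
  assumes "nbhd_graph V d N"
  shows "even (\<Sum>v\<in>V. d v)"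
  using assms
proof (induction "card V" arbitrary: V d N)
  case 0
  then show ?case by (auto simp: nbhd_graph_def)
next
  case (Suc k)
  then obtain v where v: "v \<in> V" by fastforce
  have fin: "finite V" using Suc by (simp add: nbhd_graph_def)
  have N: "N v \<subseteq> V - {v}" "card (N v) = d v" using Suc v by (auto simp: nbhd_graph_def)
  have "(\<Sum>x\<in>V - {v}. d x) = (\<Sum>x\<in>V - {v}. (d x - of_bool (x \<in> N v)) + of_bool (x \<in> N v))"
  proof (rule sum.cong)
    fix x assume x: "x \<in> V - {v}"
    \<comment> \<open>This keeps the subtraction on natural numbers from truncating.\<close>
    have "d x > 0" if "x \<in> N v"
    proof -
      have "v \<in> N x" "finite (N x)" "card (N x) = d x"
        using that x v Suc.prems fin by (auto simp: nbhd_graph_def intro: finite_subset)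
      then show ?thesis by (metis card_gt_0_iff empty_iff)
    qed
    then show "d x = (d x - of_bool (x \<in> N v)) + of_bool (x \<in> N v)" by auto
  qed simp
  also have "\<dots> = (\<Sum>x\<in>V - {v}. d x - of_bool (x \<in> N v)) + (\<Sum>x\<in>V - {v}. of_bool (x \<in> N v))"
    by (rule sum.distrib)
  also have "(\<Sum>x\<in>V - {v}. of_bool (x \<in> N v)) = d v"
  proof -
    have "(V - {v}) \<inter> {x. x \<in> N v} = N v" using N by auto
    then show ?thesis using fin N by (simp add: sum_of_bool_eq)
  qed
  finally have "(\<Sum>x\<in>V. d x) = (\<Sum>x\<in>V - {v}. d x - of_bool (x \<in> N v)) + 2 * d v"
    using v fin by (simp add: sum.remove)
  moreover have "even (\<Sum>x\<in>V - {v}. d x - of_bool (x \<in> N v))"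
    using Suc(2) v fin by (intro Suc(1)[OF _ nbhd_graph_delete[OF Suc(3) v]]) simp
  ultimately show ?case by simp
qed

text \<open>The Kleitman--Wang exchange: if \<open>u\<close> should replace \<open>w\<close> as a neighbour of \<open>v\<close>, the degree
  condition provides a neighbour \<open>z\<close> of \<open>u\<close> that is not adjacent to \<open>w\<close>, and the edges
  \<open>vw\<close>, \<open>uz\<close> are exchanged for \<open>vu\<close>, \<open>wz\<close>.\<close>
lemma nbhd_graph_top_neighbours:
  assumes "nbhd_graph V d N" "v \<in> V" "T \<subseteq> V - {v}" "card T = d v"
    and top: "\<And>u w. u \<in> T \<Longrightarrow> w \<in> V - {v} - T \<Longrightarrow> d w \<le> d u"
  shows "\<exists>N. nbhd_graph V d N \<and> N v = T"
  using assms(1)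
proof (induction "card (T - N v)" arbitrary: N rule: less_induct)
  case less
  have fin: "finite V" "finite T" using less assms(3) by (auto simp: nbhd_graph_def intro: finite_subset)
  have N: "N x \<subseteq> V - {x}" "card (N x) = d x" "finite (N x)" if "x \<in> V" for x
    using less(2) that fin by (auto simp: nbhd_graph_def intro: finite_subset)
  have sym: "x \<in> N y \<longleftrightarrow> y \<in> N x" if "x \<in> V" "y \<in> V" for x y
    using less(2) that by (auto simp: nbhd_graph_def)
  show ?case
  proof (cases "N v = T")
    case True
    then show ?thesis using less by blast
  next
    case False
    have "\<not> T \<subseteq> N v" "\<not> N v \<subseteq> T"
      using False N[OF assms(2)] fin assms(4) by (metis card_subset_eq)+
    then obtain u w where uw: "u \<in> T" "u \<notin> N v" "w \<in> N v" "w \<notin> T" by blast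
    have V: "u \<in> V" "w \<in> V" "u \<noteq> v" "w \<noteq> v" "u \<noteq> w" using uw N[OF assms(2)] assms(3) by auto
    have deg: "d w \<le> d u" using top uw V by auto
    \<comment> \<open>Possible adjacency of \<open>u\<close> and \<open>w\<close> counts once on
      each side, so it is removed from both. An inclusion would be proper because of
      \<open>v\<close>, and would give \<open>d u < d w\<close>.\<close>
    have "\<not> N u - {w} \<subseteq> N w - {u}"
    proof
      assume "N u - {w} \<subseteq> N w - {u}"
      moreover have "v \<in> N w - {u}" "v \<notin> N u - {w}" using sym uw V assms(2) by auto
      ultimately have "N u - {w} \<subset> N w - {u}" by blast
      then have "card (N u - {w}) < card (N w - {u})" using N V by (intro psubset_card_mono) auto
      then show False
        using N V deg sym[of u w] by (auto simp: card_Diff_singleton_if split: if_splits)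
    qed
    then obtain z where z: "z \<in> N u" "z \<noteq> w" "z \<notin> N w" using N(1)[OF V(1)] by blast
    have zV: "z \<in> V" "z \<noteq> u" using z N(1)[OF V(1)] by auto
    have zv: "z \<noteq> v" using z uw sym V assms(2) by auto
    have mem: "v \<notin> N u" "v \<in> N w" "u \<in> N z" "w \<notin> N z" using sym uw z V zV assms(2) by auto
    \<comment> \<open>\<open>u\<close> enters the neighbourhood of \<open>v\<close> and
      \<open>w\<close>, which is not in \<open>T\<close>, leaves it, so \<open>T - N v\<close>
      shrinks.\<close>
    define N' where "N' = N(v := insert u (N v - {w}), u := insert v (N u - {z}),
      w := insert z (N w - {v}), z := insert w (N z - {u}))"
    have swap: "card (insert p (N x - {q})) = d x" if "x \<in> V" "p \<notin> N x" "q \<in> N x" for x p q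
      using N[OF that(1)] that card_Suc_Diff1[of "N x" q] by simp
    have "nbhd_graph V d N'"
      unfolding nbhd_graph_def
    proof (intro conjI ballI)
      fix x assume "x \<in> V"
      then show "N' x \<subseteq> V - {x}"
        using N(1)[of x] assms(2) V zV zv z by (auto simp: N'_def)
      show "card (N' x) = d x"
        using \<open>x \<in> V\<close> N(2)[of x] swap mem uw z zV V assms(2) by (auto simp: N'_def)
    next
      fix x y assume "x \<in> V" "y \<in> V"
      then show "x \<in> N' y \<longleftrightarrow> y \<in> N' x"
        using sym[of x y] V zV zv z uw mem assms(2) by (auto simp: N'_def)
    qed (fact fin)
    moreover have "card (T - N' v) < card (T - N v)"
      using fin uw V zv by (intro psubset_card_mono) (auto simp: N'_def)
    ultimately show ?thesis using less(1) by blast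
  qed
qed

lemma ex_maximal_element:
  fixes d :: "'v \<Rightarrow> nat"
  assumes "finite X" "X \<noteq> {}"
  shows "\<exists>m\<in>X. \<forall>w\<in>X. d w \<le> d m"
proof -
  have "Max (d ` X) \<in> d ` X" using assms by (intro Max_in) auto
  then obtain m where "m \<in> X" "d m = Max (d ` X)" by auto
  then show ?thesis using assms by (intro bexI[of _ m]) auto
qed

lemma ex_minimal_element:
  fixes d :: "'v \<Rightarrow> nat"
  assumes "finite X" "X \<noteq> {}"
  shows "\<exists>m\<in>X. \<forall>w\<in>X. d m \<le> d w"
proof -
  have "Min (d ` X) \<in> d ` X" using assms by (intro Min_in) auto
  then obtain m where "m \<in> X" "d m = Min (d ` X)" by auto
  then show ?thesis using assms by (intro bexI[of _ m]) auto
qed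

lemma ex_top_subset:
  fixes d :: "'v \<Rightarrow> nat"
  assumes "finite X" "k \<le> card X"
  shows "\<exists>T \<subseteq> X. card T = k \<and> (\<forall>u\<in>T. \<forall>w\<in>X - T. d w \<le> d u)"
  using assms(2)
proof (induction k)
  case 0
  then show ?case by (intro exI[of _ "{}"]) auto
next
  case (Suc k)
  then obtain T where T: "T \<subseteq> X" "card T = k" "\<forall>u\<in>T. \<forall>w\<in>X - T. d w \<le> d u" by auto
  have "X \<noteq> T" using T(2) Suc.prems by auto
  then have "X - T \<noteq> {}" using T(1) by blast
  then obtain m where m: "m \<in> X - T" "\<forall>w\<in>X - T. d w \<le> d m"
    using assms(1) ex_maximal_element[of "X - T" d] by blast
  have "finite T" using T(1) assms(1) by (rule finite_subset)
  then have "card (insert m T) = Suc k" using m(1) T(2) by simp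
  moreover have "\<forall>u\<in>insert m T. \<forall>w\<in>X - insert m T. d w \<le> d u" using T(3) m(2) by blast
  moreover have "insert m T \<subseteq> X" using T(1) m(1) by blast
  ultimately show ?case by blast
qed

text \<open>The excluded sequences as unordered degree functions, with the conditions in additive
  form since subtraction of natural numbers truncates.\<close>

definition exceptional :: "'v set \<Rightarrow> ('v \<Rightarrow> nat) \<Rightarrow> bool" where
  "exceptional V d \<longleftrightarrow>
     (\<exists>u\<in>V. (\<forall>v\<in>V - {u}. d v = 3) \<and> (d u + 3 = card V \<or> even (card V) \<and> d u + 1 = card V)) \<or>
     even (card V) \<and> (\<exists>u\<in>V. \<exists>w\<in>V. u \<noteq> w \<and> d u + 1 = card V \<and> d w + 1 = card V \<and> (\<forall>v\<in>V - {u, w}. d v = 3))"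

text \<open>\<open>realizable_two_large\<close> needs a vertex of maximal degree and the parity of
  the degree sum; the latter comes from the handshake lemma.\<close>

lemma Z3_realizable_at_most_two_large:
  assumes G: "nbhd_graph V d N" and three: "\<And>x. x \<in> V \<Longrightarrow> 3 \<le> d x"
    and hub: "u0 \<in> V" "card V \<le> d u0 + 3" and exc: "\<not> exceptional V d"
    and pq: "p \<in> V" "q \<in> V" "p \<noteq> q" "\<And>x. x \<in> V - {p, q} \<Longrightarrow> d x = 3"
  shows "Z3_realizable V d"
proof -
  have fin: "finite V" using G by (simp add: nbhd_graph_def)
  obtain u where u: "u \<in> V" "\<forall>w\<in>V. d w \<le> d u"
    using fin hub(1) ex_maximal_element[of V d] by blast
  \<comment> \<open>The maximal vertex \<open>u\<close> can lie outside \<open>{p, q}\<close> only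
    if all degrees are 3, and then either of \<open>p\<close>, \<open>q\<close> can serve as
    \<open>w\<close>.\<close>
  obtain w where w: "w \<in> V" "w \<noteq> u" "w \<in> {p, q}" using pq(1-3) by blast
  have rest: "d x = 3" if "x \<in> V" "x \<noteq> u" "x \<noteq> w" for x
  proof (cases "x \<in> {p, q}")
    case True
    then have "u \<in> V - {p, q}" using that w u by auto
    then have "d u = 3" by (rule pq)
    then show ?thesis using u three[of x] that by (metis le_antisym)
  qed (use that pq in auto)
  have "(\<Sum>x\<in>V. d x) = d u + (d w + (\<Sum>x\<in>V - {u} - {w}. d x))"
    using fin u w by (simp add: sum.remove)
  also have "(\<Sum>x\<in>V - {u} - {w}. d x) = (\<Sum>x\<in>V - {u} - {w}. 3)"
    by (rule sum.cong) (use rest in auto)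
  also have "\<dots> = 3 * (card V - 2)" using fin u w by (simp add: card_Diff_singleton_if)
  finally have "even (d u + (d w + 3 * (card V - 2)))" using nbhd_graph_even_sum[OF G] by simp
  moreover have "card V \<ge> 2" using nbhd_graph_degree_less[OF G u(1)] three[OF u(1)] by simp
  ultimately have par: "even (card V + d u + d w)" by presburger
  show ?thesis
  proof (rule realizable_two_large[of u V w])
    show "card V - 3 \<le> d u" using hub u by force
    show "d u \<le> card V - 1" using nbhd_graph_degree_less[OF G u(1)] by simp
    show "\<not> (d u = card V - 3 \<and> d w = 3)"
    proof
      assume *: "d u = card V - 3 \<and> d w = 3"
      then have "d u + 3 = card V" using three[OF u(1)] by linarith
      moreover have "\<forall>v\<in>V - {u}. d v = 3" using * rest by auto
      ultimately show False using exc u(1) unfolding exceptional_def by blast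
    qed
    show "\<not> (even (card V) \<and> d u = card V - 1 \<and> (d w = 3 \<or> d w = card V - 1))"
    proof safe
      assume *: "even (card V)" "d u = card V - 1" "d w = 3"
      then have "d u + 1 = card V" using three[OF u(1)] by linarith
      moreover have "\<forall>v\<in>V - {u}. d v = 3" using * rest by auto
      ultimately show False using exc u(1) * unfolding exceptional_def by blast
    next
      assume *: "even (card V)" "d u = card V - 1" "d w = card V - 1"
      then have "d u + 1 = card V" "d w + 1 = card V" using three[OF u(1)] by linarith+
      moreover have "\<forall>v\<in>V - {u, w}. d v = 3" using rest by auto
      ultimately show False using exc u(1) w * unfolding exceptional_def by metis
    qed
  qed (use u w rest three par in auto)
qed

lemma card3_obtain:
  assumes "card T = 3" "u \<in> T"
  obtains p q where "T = {u, p, q}" "distinct [u, p, q]"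
proof -
  have "card (T - {u}) = 2" using assms by simp
  then obtain p q where "T - {u} = {p, q}" "p \<noteq> q" by (auto simp: card_2_iff)
  then show ?thesis using that[of p q] assms(2) by auto
qed

text \<open>In these two orders a degree 4 is itself the large degree: \<open>card V - 1\<close> for
  five vertices, \<open>card V - 3\<close> for seven.\<close>

lemma realizable_three_fours:
  assumes "card T = 3" "T \<subseteq> V" "\<And>x. x \<in> T \<Longrightarrow> d x = 4" "\<And>x. x \<in> V - T \<Longrightarrow> d x = 3"
    and "card V = 5 \<or> card V = 7"
  shows "Z3_realizable V d"
proof -
  obtain p where "p \<in> T" using assms(1) by fastforce
  then obtain q r where T: "T = {p, q, r}" "distinct [p, q, r]" using assms(1) card3_obtain by metis
  show ?thesis
    using assms(5)
  proof
    assume "card V = 5"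
    then show ?thesis by (intro realizable_n1_4_4[of V p q r]) (use T assms in auto)
  next
    assume "card V = 7"
    then show ?thesis by (intro realizable_n3_4_4[of V p q r]) (use T assms in auto)
  qed
qed

text \<open>The induction passes through the deletion of \<open>v\<close> unless some vertex of
  \<open>T\<close> has degree 3 or the remainder is exceptional. In the latter case \<open>d\<close>
  is known up to the choice of \<open>T\<close>, and \<open>T\<close> is restricted by consisting of
  largest degrees.\<close>

lemma Z3_realizable_nbhd_graph:
  assumes "nbhd_graph V d N" "\<And>x. x \<in> V \<Longrightarrow> 3 \<le> d x"
    and "u0 \<in> V" "card V \<le> d u0 + 3" "\<not> exceptional V d"
  shows "Z3_realizable V d"
  using assms
proof (induction "card V" arbitrary: V d N u0)
  case 0
  then show ?case by (auto simp: nbhd_graph_def)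
next
  case (Suc k)
  note G = Suc.prems(1) and three = Suc.prems(2) and hub = Suc.prems(3,4) and exc = Suc.prems(5)
  have fin: "finite V" using G by (simp add: nbhd_graph_def)
  have less: "d x < card V" if "x \<in> V" for x using nbhd_graph_degree_less[OF G that] .
  have n4: "card V \<ge> 4" using less[OF hub(1)] three[OF hub(1)] by simp
  obtain v where v: "v \<in> V" "\<forall>x\<in>V. d v \<le> d x"
    using fin hub(1) ex_minimal_element[of V d] by blast
  let ?V = "V - {v}"
  have cV: "card ?V = card V - 1" using v fin by simp
  obtain T where T: "T \<subseteq> ?V" "card T = d v" "\<forall>u\<in>T. \<forall>w\<in>?V - T. d w \<le> d u"
  proof -
    have "d v \<le> card ?V" using cV less[OF v(1)] by simp
    then show ?thesis using ex_top_subset[of ?V "d v" d] fin that by blast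
  qed
  have finT: "finite T" using T fin finite_subset by blast
  obtain N' where N': "nbhd_graph V d N'" "N' v = T"
    using nbhd_graph_top_neighbours[OF G v(1) T(1,2)] T(3) by blast
  define d' where "d' = (\<lambda>x. d x - of_bool (x \<in> T))"
  have G': "nbhd_graph ?V d' (\<lambda>x. N' x - {v})"
    using nbhd_graph_delete[OF N'(1) v(1)] N'(2) by (simp add: d'_def)
  show ?case
  proof (cases "\<exists>w\<in>T. d w = 3")
    case True
    then obtain w where w: "w \<in> T" "d w = 3" by blast
    then have "d v = 3" using v three[OF v(1)] T by fastforce
    then obtain p q where pq: "T = {w, p, q}" "distinct [w, p, q]"
      using T w card3_obtain by metis
    \<comment> \<open>\<open>T\<close> consists of largest degrees and contains \<open>w\<close> of
      degree 3, so only \<open>p\<close> and \<open>q\<close> can have larger degree.\<close>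
    have "d x = 3" if "x \<in> V - {p, q}" for x
    proof -
      have "d x \<le> 3" using that w T pq \<open>d v = 3\<close> by (cases "x = v"; cases "x = w") auto
      then show ?thesis using three[of x] that by auto
    qed
    then show ?thesis using pq T by (intro Z3_realizable_at_most_two_large[OF G three hub exc, of p q]) auto
  next
    case False
    have T4: "4 \<le> d x" if "x \<in> T" for x
    proof -
      have "x \<in> V" using that T by auto
      then have "3 \<le> d x" using three by blast
      moreover have "d x \<noteq> 3" using False that by blast
      ultimately show ?thesis by linarith
    qed
    have d'T: "d x = d' x + 1" if "x \<in> T" for x using T4[OF that] that by (simp add: d'_def)
    have d'N: "d x = d' x" if "x \<notin> T" for x using that by (simp add: d'_def)
    have three': "3 \<le> d' x" if "x \<in> ?V" for x
      using that T4[of x] three[of x] by (auto simp: d'_def)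
    show ?thesis
    proof (cases "exceptional ?V d'")
      case False
      \<comment> \<open>If the vertex with the large degree is \<open>v\<close> itself, then by
        minimality every degree is that large, and any member of \<open>T\<close> can take
        over.\<close>
      have "\<exists>u\<in>?V. card ?V \<le> d' u + 3"
      proof (cases "u0 = v")
        case True
        obtain x where "x \<in> T" using T three[OF v(1)] by fastforce
        moreover have "d v \<le> d x" using v T calculation by auto
        ultimately show ?thesis using True hub T cV d'T[of x] by (intro bexI[of _ x]) auto
      next
        case False
        then show ?thesis using hub cV d'T[of u0] d'N[of u0] by (intro bexI[of _ u0]) (cases "u0 \<in> T"; auto)+
      qed
      then obtain u where u: "u \<in> ?V" "card ?V \<le> d' u + 3" by blast
      have "Z3_realizable ?V d'"
        by (rule Suc(1)[OF _ G' three' u False]) (use Suc(2) cV in auto)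
      then have "Z3_realizable (insert v ?V) (\<lambda>x. if x = v then card T else if x \<in> T then d' x + 1 else d' x)"
        using T three[OF v(1)] by (intro Z3_realizable_absorb) auto
      then show ?thesis
        by (rule Z3_realizable_cong) (use v T d'T d'N in auto)
    next
      case True
      have K5: ?thesis if "\<And>x. x \<in> V \<Longrightarrow> 4 \<le> d x" "card V = 5"
      proof (rule Z3_realizable_K5[OF that(2)])
        fix x assume "x \<in> V"
        then show "d x = 4" using that(1)[of x] less[of x] that(2) by linarith
      qed
      \<comment> \<open>If the minimum degree is at least 4, a vertex left with degree 3 must have
        lost an edge, so nearly all vertices lie in \<open>T\<close>. As \<open>T\<close> has only
        \<open>d v\<close> elements, this bounds \<open>card V\<close>.\<close>
      have only3: "x \<in> T \<and> d x = 4" if "4 \<le> d v" "x \<in> ?V" "d' x = 3" for x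
      proof -
        have "4 \<le> d x" using that v by force
        then show ?thesis using that(3) d'T[of x] d'N[of x] by (cases "x \<in> T") simp_all
      qed
      consider (E1) u where "u \<in> ?V" "\<forall>x\<in>?V - {u}. d' x = 3" "d' u + 3 = card ?V"
        | (E2) u where "u \<in> ?V" "\<forall>x\<in>?V - {u}. d' x = 3" "d' u + 1 = card ?V" "even (card ?V)"
        | (E3) u w where "u \<in> ?V" "w \<in> ?V" "u \<noteq> w" "\<forall>x\<in>?V - {u, w}. d' x = 3" "d' u + 1 = card ?V"
            "d' w + 1 = card ?V" "even (card ?V)"
        using True unfolding exceptional_def by blast
      then show ?thesis
      proof cases
        case E1
        have n7: "card V \<ge> 7" using E1 three'[of u] cV by simp
        have "d v = 3"
        proof (rule ccontr)
          assume "d v \<noteq> 3"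
          then have 4: "4 \<le> d v" using three[OF v(1)] by simp
          have sub: "?V - {u} \<subseteq> T" using only3[OF 4] E1 by auto
          have c: "card (?V - {u}) = card V - 2" using cV E1 fin by simp
          then have "0 < card (?V - {u})" using n7 by simp
          then have "?V - {u} \<noteq> {}" using card_gt_0_iff by blast
          then obtain x where x: "x \<in> ?V - {u}" by blast
          have "d x = 4" using only3[OF 4] x E1 by auto
          then have "d v \<le> 4" using v x by auto
          moreover have "card V - 2 \<le> d v" using card_mono[OF finT sub] T c by simp
          ultimately show False using n7 by simp
        qed
        then have cT: "card T = 3" using T by simp
        show ?thesis
        proof (cases "u \<in> T")
          case True
          then obtain p q where pq: "T = {u, p, q}" "distinct [u, p, q]" using cT card3_obtain by metis
          show ?thesis
          proof (rule realizable_n3_4_4[of V u p q])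
            show "{u, p, q} \<subseteq> V" using pq T(1) by auto
            show "d u = card V - 3" using d'T[OF True] E1(3) cV by simp
            show "d p = 4" using d'T[of p] E1(2) pq T(1) by auto
            show "d q = 4" using d'T[of q] E1(2) pq T(1) by auto
            fix x assume "x \<in> V - {u, p, q}"
            then show "d x = 3" using E1(2) d'N[of x] \<open>d v = 3\<close> pq(1) by (cases "x = v") auto
          qed (use n7 pq in auto)
        next
          case False
          \<comment> \<open>All of \<open>T\<close> has degree 4 and consists of largest degrees, so
            \<open>u\<close> outside \<open>T\<close> has degree at most 4. Hence no degree exceeds
            4, and the hub bound forces seven vertices.\<close>
          have dT: "d x = 4" if "x \<in> T" for x using that E1 d'T[of x] T False by auto
          obtain t where "t \<in> T" using cT by fastforce
          then have "d u \<le> 4" using T(3) E1(1) False dT by force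
          then have le4: "d x \<le> 4" if "x \<in> V" for x
            using that E1 d'N[of x] dT[of x] \<open>d v = 3\<close> by (cases "x = u"; cases "x = v"; cases "x \<in> T") auto
          then have "card V = 7" using le4[OF hub(1)] hub(2) n7 by simp
          moreover have "d x = 3" if "x \<in> V - T" for x
            using that E1 d'N[of x] \<open>d v = 3\<close> \<open>card V = 7\<close> cV by (cases "x = u"; cases "x = v") auto
          ultimately show ?thesis using cT T dT by (intro realizable_three_fours[of T]) auto
        qed
      next
        case E2
        have odd: "odd (card V)" using E2 cV n4 by auto
        then have n5: "card V \<ge> 5" using n4 by presburger
        show ?thesis
        proof (cases "d v = 3")
          case False
          then have 4: "4 \<le> d v" using three[OF v(1)] by simp
          have sub: "?V - {u} \<subseteq> T" using only3[OF 4] E2 by auto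
          have c: "card (?V - {u}) = card V - 2" using cV E2 fin by simp
          then have "0 < card (?V - {u})" using n5 by simp
          then have "?V - {u} \<noteq> {}" using card_gt_0_iff by blast
          then obtain x where x: "x \<in> ?V - {u}" by blast
          have "d x = 4" using only3[OF 4] x E2 by auto
          then have "d v \<le> 4" using v x by auto
          moreover have "card V - 2 \<le> d v" using card_mono[OF finT sub] T c by simp
          ultimately have "card V = 5" using n5 odd by presburger
          then show ?thesis using K5 4 v by (meson le_trans)
        next
          case True
          then have cT: "card T = 3" using T by simp
          show ?thesis
          proof (cases "u \<in> T")
            case True
            then obtain p q where pq: "T = {u, p, q}" "distinct [u, p, q]" using cT card3_obtain by metis
            show ?thesis
            proof (rule realizable_n1_4_4[of V u p q])
              show "{u, p, q} \<subseteq> V" using pq T(1) by auto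
              show "d u = card V - 1" using d'T[OF True] E2(3) cV by simp
              show "d p = 4" using d'T[of p] E2(2) pq T(1) by auto
              show "d q = 4" using d'T[of q] E2(2) pq T(1) by auto
              fix x assume "x \<in> V - {u, p, q}"
              then show "d x = 3" using E2(2) d'N[of x] \<open>d v = 3\<close> pq(1) by (cases "x = v") auto
            qed (use n5 odd pq in auto)
          next
            case False
            have dT: "d x = 4" if "x \<in> T" for x using that E2 d'T[of x] T False by auto
            obtain t where "t \<in> T" using cT by fastforce
            then have "d u \<le> 4" using T(3) E2(1) False dT by force
            then have "card V = 5" using E2 d'N[OF False] cV n5 odd by presburger
            moreover have "d x = 3" if "x \<in> V - T" for x
              using that E2 d'N[of x] \<open>d v = 3\<close> \<open>card V = 5\<close> cV by (cases "x = u"; cases "x = v") auto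
            ultimately show ?thesis using cT T dT by (intro realizable_three_fours[of T]) auto
          qed
        qed
      next
        case E3
        have odd: "odd (card V)" using E3 cV n4 by auto
        then have n5: "card V \<ge> 5" using n4 by presburger
        have c: "card (?V - {u, w}) = card V - 3" using cV E3 fin by (simp add: card_Diff_subset)
        show ?thesis
        proof (cases "d v = 3")
          case False
          then have 4: "4 \<le> d v" using three[OF v(1)] by simp
          have sub: "?V - {u, w} \<subseteq> T" using only3[OF 4] E3 by auto
          have "0 < card (?V - {u, w})" using n5 c by simp
          then have "?V - {u, w} \<noteq> {}" using card_gt_0_iff by blast
          then obtain x where x: "x \<in> ?V - {u, w}" by blast
          have dx: "d x = 4" using only3[OF 4] x E3 by auto
          then have "d v = 4" using v x 4 by (metis DiffD1 le_antisym)
          moreover have "card V - 3 \<le> d v" using card_mono[OF finT sub] T c by simp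
          ultimately have "card V = 5 \<or> card V = 7" using n5 odd by presburger
          then show ?thesis
          proof
            assume "card V = 5"
            then show ?thesis using K5 4 v by (meson le_trans)
          next
            \<comment> \<open>Now \<open>T\<close> would be exactly \<open>?V - {u, w}\<close>, all
              of degree 4, whereas \<open>u\<close> outside \<open>T\<close> has degree 5, against
              the choice of \<open>T\<close>.\<close>
            assume 7: "card V = 7"
            then have "?V - {u, w} = T" using sub finT c T \<open>d v = 4\<close> by (intro card_subset_eq) auto
            then have "u \<notin> T" "x \<in> T" using x by auto
            then have "d u \<le> 4" using T(3) E3(1) dx by force
            then show ?thesis using E3 d'N[OF \<open>u \<notin> T\<close>] cV 7 by simp
          qed
        next
          case True
          then have cT: "card T = 3" using T by simp
          show ?thesis
          proof (cases "card V = 5")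
            case True
            have all: "d' x = 3" if "x \<in> ?V" for x
              using that E3 True cV by (cases "x \<in> {u, w}") auto
            have "d x = 4" if "x \<in> T" for x using that all[of x] d'T[of x] T by auto
            moreover have "d x = 3" if "x \<in> V - T" for x
              using that all[of x] d'N[of x] \<open>d v = 3\<close> by (cases "x = v") auto
            ultimately show ?thesis using cT T True by (intro realizable_three_fours[of T]) auto
          next
            case False
            then have n7: "card V \<ge> 7" using n5 odd by presburger
            \<comment> \<open>Were \<open>a\<close> outside \<open>T\<close>, every member of
              \<open>T\<close> would have degree at least 5. Only \<open>u\<close> and
              \<open>w\<close> can, which is too few for the three elements of
              \<open>T\<close>.\<close>
            have inT: "a \<in> T" if a: "a \<in> {u, w}" for a
            proof (rule ccontr)
              assume "a \<notin> T"
              then have a5: "d a \<ge> 5" using a E3 d'N[of a] n7 cV by auto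
              have aV: "a \<in> ?V - T" using a E3(1,2) \<open>a \<notin> T\<close> by blast
              have "t \<in> {u, w} - {a}" if "t \<in> T" for t
              proof -
                have "5 \<le> d t" using T(3) that aV a5 le_trans by blast
                then have "d' t \<noteq> 3" using d'T[OF that] by simp
                then have "t \<in> {u, w}" using E3(4) that T(1) by blast
                then show ?thesis using that \<open>a \<notin> T\<close> by blast
              qed
              then have "T \<subseteq> {u, w} - {a}" by blast
              then have "card T \<le> card ({u, w} - {a})" by (intro card_mono) auto
              also have "\<dots> \<le> card {u, w}" by (intro card_mono) auto
              also have "\<dots> \<le> 2" by (simp add: card_insert_if)
              finally show False using cT by simp
            qed
            obtain p q where pq: "T = {u, p, q}" "distinct [u, p, q]" using cT card3_obtain inT by (metis insertI1)
            then obtain z where z: "T = {u, w, z}" "distinct [u, w, z]" using inT[of w] E3(3) by auto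
            show ?thesis
            proof (rule realizable_n1_n1_4[of V u w z])
              show "{u, w, z} \<subseteq> V" using z T(1) by auto
              show "d u = card V - 1" using d'T[OF inT[of u]] E3(5) cV by simp
              show "d w = card V - 1" using d'T[OF inT[of w]] E3(6) cV by simp
              show "d z = 4" using d'T[of z] E3(4) z T(1) by auto
              fix x assume "x \<in> V - {u, w, z}"
              then show "d x = 3" using E3(4) d'N[of x] \<open>d v = 3\<close> z(1) by (cases "x = v") auto
            qed (use n5 odd z in auto)
          qed
        qed
      qed
    qed
  qed
qed

section \<open>Degree sequences\<close>

text \<open>The bridge to the graph notion: the derivation of a flow is turned edge by edge into
  tail and head functions.\<close>

lemma flow_orientation:
  assumes "finite E" "\<And>e. e \<in> E \<Longrightarrow> card e = 2" "flow (mset_set E) c"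
  shows "\<exists>tail head. (\<forall>e\<in>E. {tail e, head e} = e) \<and>
    (\<forall>v. (\<Sum>e\<in>E. of_bool (tail e = v) - of_bool (head e = v)) = c v)"
  using assms
proof (induction E arbitrary: c rule: finite_induct)
  case empty
  then have "flow {#} c" by simp
  then show ?case by (cases rule: flow.cases) auto
next
  case (insert e E)
  obtain u w where e: "e = {u, w}" "u \<noteq> w" using insert.prems(1)[of e] by (auto simp: card_2_iff)
  have "flow (add_mset {u, w} (mset_set E)) c" using insert e by simp
  then obtain s where s: "s = 1 \<or> s = -1" "flow (mset_set E) (\<lambda>z. c z - s * (of_bool (z = u) - of_bool (z = w)))"
    using e(2) by (rule flow_addE)
  \<comment> \<open>The sign \<open>s = -1\<close> is absorbed by exchanging tail and head.\<close>
  obtain x y where xy: "{x, y} = e" "flow (mset_set E) (\<lambda>z. c z - (of_bool (z = x) - of_bool (z = y)))"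
  proof (cases "s = 1")
    case True
    then show ?thesis using that[of u w] s e by simp
  next
    case False
    then have "(\<lambda>z. c z - s * (of_bool (z = u) - of_bool (z = w))) = (\<lambda>z. c z - (of_bool (z = w) - of_bool (z = u)))"
      using s(1) by (auto simp: fun_eq_iff)
    then show ?thesis using that[of w u] s e by (simp add: insert_commute)
  qed
  obtain tail head where th: "\<forall>e\<in>E. {tail e, head e} = e"
    "\<And>v. (\<Sum>e\<in>E. of_bool (tail e = v) - of_bool (head e = v)) = c v - (of_bool (v = x) - of_bool (v = y))"
    using insert.IH[OF _ xy(2)] insert.prems(1) by auto
  have "(\<Sum>e'\<in>insert e E. of_bool ((tail(e := x)) e' = v) - of_bool ((head(e := y)) e' = v)) = c v" for v
  proof -
    have "(\<Sum>e'\<in>E. of_bool ((tail(e := x)) e' = v) - of_bool ((head(e := y)) e' = v)) =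
      (\<Sum>e'\<in>E. of_bool (tail e' = v) - of_bool (head e' = v) :: Z3)"
      using insert(2) by (intro sum.cong) auto
    then show ?thesis using insert(1,2) th(2)[of v] by (simp add: eq_commute[of v])
  qed
  moreover have "\<forall>e'\<in>insert e E. {(tail(e := x)) e', (head(e := y)) e'} = e'"
    using th(1) xy(1) insert(2) by auto
  ultimately show ?case by blast
qed

definition mgraph_of :: "'v set \<Rightarrow> 'v set multiset \<Rightarrow> ('v, 'v set) mgraph" where
  "mgraph_of V M = \<lparr>verts = V, edges = set_mset M, ends = id\<rparr>"

lemma simple_mset_set:
  assumes "simple V M"
  shows "mset_set (set_mset M) = M"
proof (rule multiset_eqI)
  fix e
  have "count M e \<le> 1" using assms by (simp add: simple_def)
  then have "count M e = of_bool (e \<in># M)"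
    by (cases "e \<in># M") (simp_all add: not_in_iff le_antisym Suc_leI)
  then show "count (mset_set (set_mset M)) e = count M e"
    by (simp only: count_mset_set') simp
qed

lemma simple_graph_mgraph_of:
  assumes "finite V" "simple V M"
  shows "simple_graph (mgraph_of V M)"
  using assms by (auto simp: simple_graph_def loopfree_multigraph_def mgraph_of_def simple_def)

lemma degree_mgraph_of:
  assumes "simple V M"
  shows "degree (mgraph_of V M) v = deg M v"
proof -
  have "deg M v = size (filter_mset (\<lambda>e. v \<in> e) (mset_set (set_mset M)))"
    by (simp add: deg_def simple_mset_set[OF assms])
  then show ?thesis
    by (simp add: filter_mset_mset_set degree_def mgraph_of_def)
qed

lemma Z3_connected_mgraph_of:
  assumes "simple V M" "Z3_conn V M"
  shows "Z3_connected (mgraph_of V M)"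
  unfolding Z3_connected_def
proof (intro conjI allI impI)
  have fin: "finite V" using assms(2) by (simp add: Z3_conn_def)
  show "loopfree_multigraph (mgraph_of V M)"
    using simple_graph_mgraph_of[OF fin assms(1)] by (simp add: simple_graph_def)
  fix b assume "zero_sum (mgraph_of V M) b"
  then have b: "(\<Sum>v\<in>V. b v) = 0" by (simp add: zero_sum_def mgraph_of_def)
  \<comment> \<open>\<open>Z3_conn\<close> concerns demands that vanish outside \<open>V\<close>,
    while \<open>b\<close> is arbitrary there.\<close>
  let ?c = "\<lambda>v. if v \<in> V then b v else 0"
  have "flow M ?c" by (rule Z3_connD[OF assms(2)]) (use b in auto)
  then have "flow (mset_set (set_mset M)) ?c" by (simp add: simple_mset_set[OF assms(1)])
  from flow_orientation[OF _ _ this] obtain tail head where th: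
    "\<forall>e\<in>set_mset M. {tail e, head e} = e"
    "\<And>v. (\<Sum>e\<in>set_mset M. of_bool (tail e = v) - of_bool (head e = v)) = ?c v"
    using assms(1) by (auto simp: simple_def)
  have "boundary (mgraph_of V M) tail head (\<lambda>_. 1) v = b v" if "v \<in> V" for v
    using th(2)[of v] that
    by (simp add: boundary_def mgraph_of_def sum_subtractf sum.inter_filter[symmetric] of_bool_def)
  then show "\<exists>tail head f. orientation (mgraph_of V M) tail head \<and> (\<forall>e\<in>edges (mgraph_of V M). f e \<noteq> 0) \<and>
      (\<forall>v\<in>verts (mgraph_of V M). boundary (mgraph_of V M) tail head f v = b v)"
    using th(1) by (intro exI[of _ tail] exI[of _ head] exI[of _ "\<lambda>_. 1"])
      (simp add: orientation_def mgraph_of_def)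
qed

text \<open>Degrees count edges and neighbourhoods count vertices; injectivity of
  \<open>ends\<close> makes the two agree.\<close>

lemma nbhd_graph_of_simple_graph:
  assumes "simple_graph G"
  shows "nbhd_graph (verts G) (degree G) (\<lambda>v. {w. w \<noteq> v \<and> {v, w} \<in> ends G ` edges G})"
proof -
  have fin: "finite (verts G)" and inj: "inj_on (ends G) (edges G)"
    and sub: "\<And>e. e \<in> edges G \<Longrightarrow> ends G e \<subseteq> verts G" and c2: "\<And>e. e \<in> edges G \<Longrightarrow> card (ends G e) = 2"
    using assms by (auto simp: simple_graph_def loopfree_multigraph_def)
  have "card {w. w \<noteq> v \<and> {v, w} \<in> ends G ` edges G} = degree G v" for v
  proof -
    let ?N = "{w. w \<noteq> v \<and> {v, w} \<in> ends G ` edges G}"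
    have "degree G v = card (ends G ` {e \<in> edges G. v \<in> ends G e})"
      unfolding degree_def using inj by (subst card_image) (auto simp: inj_on_def)
    also have "ends G ` {e \<in> edges G. v \<in> ends G e} = (\<lambda>w. {v, w}) ` ?N"
    proof safe
      fix e assume e: "e \<in> edges G" "v \<in> ends G e"
      obtain x y where xy: "ends G e = {x, y}" "x \<noteq> y" using c2[OF e(1)] by (auto simp: card_2_iff)
      have "\<exists>w. ends G e = {v, w} \<and> w \<noteq> v"
      proof (cases "v = x")
        case True
        then show ?thesis using xy by (intro exI[of _ y]) auto
      next
        case False
        then have "v = y" using e(2) xy(1) by auto
        then show ?thesis using xy by (intro exI[of _ x]) auto
      qed
      then obtain w where w: "ends G e = {v, w}" "w \<noteq> v" by blast
      then have "{v, w} \<in> ends G ` edges G" using e(1) by (intro image_eqI[of _ _ e]) auto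
      then have "w \<in> ?N" using w(2) by simp
      then show "ends G e \<in> (\<lambda>w. {v, w}) ` ?N" unfolding w(1) by (rule imageI)
    next
      fix w e assume "w \<noteq> v" "{v, w} = ends G e" "e \<in> edges G"
      then show "{v, w} \<in> ends G ` {e \<in> edges G. v \<in> ends G e}" by auto
    qed
    also have "card \<dots> = card ?N" by (rule card_image) (auto simp: inj_on_def doubleton_eq_iff)
    finally show ?thesis by simp
  qed
  moreover have "w \<in> verts G" if "{v, w} = ends G e" "e \<in> edges G" for v w e
    using sub[OF that(2)] that(1) by auto
  ultimately show ?thesis
    unfolding nbhd_graph_def using fin by (auto simp: insert_commute)
qed

lemma sorted_desc_mset_unique:
  fixes xs ys :: "int list"
  assumes "sorted_wrt (\<ge>) xs" "sorted_wrt (\<ge>) ys" "mset xs = mset ys"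
  shows "xs = ys"
proof -
  have "sorted (rev xs)" "sorted (rev ys)" using assms by (simp_all add: sorted_wrt_rev)
  moreover have "mset (rev xs) = mset (rev ys)" using assms by simp
  ultimately have "rev xs = rev ys" by (metis properties_for_sort)
  then show ?thesis by simp
qed

text \<open>A weakly decreasing list is determined by its multiset, so it suffices to compare
  multisets with lists that are visibly decreasing; these are decreasing because no degree is below
  3.\<close>

lemma exceptional_list:
  fixes \<pi> :: "int list"
  assumes "finite V" "mset \<pi> = image_mset (\<lambda>v. int (d v)) (mset_set V)" "sorted_wrt (\<ge>) \<pi>"
    and three: "\<And>v. v \<in> V \<Longrightarrow> 3 \<le> d v" and "exceptional V d" "length \<pi> = n"
  shows "\<pi> = (int n - 3) # replicate (n - 1) 3 \<or>
    (\<exists>k. k = n - 1 \<and> even n \<and> (\<pi> = int k # replicate k 3 \<or> \<pi> = replicate 2 (int k) @ replicate (k - 1) 3))"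
proof -
  have n: "n = card V" using assms(2,6) by (metis size_image_mset size_mset size_mset_set)
  have const: "image_mset (\<lambda>v. int (d v)) (mset_set X) = replicate_mset (card X) 3"
    if "\<forall>v\<in>X. d v = 3" for X
  proof (cases "finite X")
    case True
    then have "image_mset (\<lambda>v. int (d v)) (mset_set X) = image_mset (\<lambda>_. 3) (mset_set X)"
      using that by (intro image_mset_cong) auto
    then show ?thesis by (simp add: image_mset_const_eq)
  qed simp
  have rep: "sorted_wrt (\<ge>) (replicate k x)" for k and x :: int
    by (induction k) auto
  have one: "\<pi> = int (d u) # replicate (n - 1) 3" if u: "u \<in> V" "\<forall>v\<in>V - {u}. d v = 3" for u
  proof (rule sorted_desc_mset_unique[OF assms(3)])
    have "mset_set V = add_mset u (mset_set (V - {u}))" using u assms(1) by (simp add: mset_set.remove)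
    then show "mset \<pi> = mset (int (d u) # replicate (n - 1) 3)"
      using const[OF u(2)] u assms(1,2) by (simp add: n)
    show "sorted_wrt (\<ge>) (int (d u) # replicate (n - 1) 3)"
      using three[OF u(1)] by (auto simp: rep)
  qed
  have two: "\<pi> = replicate 2 (int (d u)) @ replicate (n - 2) 3"
    if u: "u \<in> V" "w \<in> V" "u \<noteq> w" "d u = d w" "\<forall>v\<in>V - {u, w}. d v = 3" for u w
  proof (rule sorted_desc_mset_unique[OF assms(3)])
    have "mset_set V = mset_set (insert u (insert w (V - {u, w})))"
      using u by (intro arg_cong[of _ _ mset_set]) auto
    also have "\<dots> = add_mset u (add_mset w (mset_set (V - {u, w})))" using u assms(1) by simp
    finally show "mset \<pi> = mset (replicate 2 (int (d u)) @ replicate (n - 2) 3)"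
      using const[OF u(5)] card_minus_pair[OF assms(1) u(1-3)] assms(2) u(4)
      by (simp add: n numeral_2_eq_2)
    show "sorted_wrt (\<ge>) (replicate 2 (int (d u)) @ replicate (n - 2) 3)"
      using three[OF u(1)] by (auto simp: sorted_wrt_append rep)
  qed
  consider u where "u \<in> V" "\<forall>v\<in>V - {u}. d v = 3" "d u + 3 = n"
    | u where "u \<in> V" "\<forall>v\<in>V - {u}. d v = 3" "even n" "d u + 1 = n"
    | u w where "u \<in> V" "w \<in> V" "u \<noteq> w" "\<forall>v\<in>V - {u, w}. d v = 3" "even n" "d u + 1 = n" "d w + 1 = n"
    using assms(5) unfolding exceptional_def n by blast
  then show ?thesis
  proof cases
    case 1
    then have "int (d u) = int n - 3" by linarith
    then show ?thesis using one[OF 1(1,2)] by simp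
  next
    case 2
    then have "d u = n - 1" by linarith
    then show ?thesis using one[OF 2(1,2)] 2(3) by simp
  next
    case 3
    then have "d u = n - 1" "d u = d w" by linarith+
    then show ?thesis using two[OF 3(1-3) _ 3(4)] 3(5) by (simp add: numeral_2_eq_2)
  qed
qed

theorem theorem1p4:
  fixes n :: nat and \<pi> :: "int list"
  assumes "n \<ge> 1"
    and "length \<pi> = n"
    and "graphic \<pi>"
    and "sorted_wrt (\<ge>) \<pi>"
    and "\<pi> ! 0 \<ge> int n - 3"
    and "\<pi> ! (n - 1) \<ge> 3"
    and "\<not> (\<pi> = (int n - 3) # replicate (n - 1) 3 \<or>
             (\<exists>k. k = n - 1 \<and> even n \<and>
                (\<pi> = int k # replicate k 3 \<or>
                 \<pi> = replicate 2 (int k) @ replicate (k - 1) 3)))"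
  shows "has_Z3_connected_realization \<pi>"
proof -
  obtain G :: "(nat, nat set) mgraph" where G: "simple_graph G" "degree_sequence G = mset \<pi>"
    using assms(3) by (auto simp: graphic_def realization_def)
  let ?V = "verts G" and ?d = "degree G"
  have fin: "finite ?V" using G by (simp add: simple_graph_def loopfree_multigraph_def)
  have mset: "mset \<pi> = image_mset (\<lambda>v. int (?d v)) (mset_set ?V)"
    using G(2) by (simp add: degree_sequence_def)
  have card: "card ?V = n" using mset assms(2) by (metis size_image_mset size_mset size_mset_set)
  have set: "set \<pi> = (\<lambda>v. int (?d v)) ` ?V"
    using arg_cong[OF mset, of set_mset] fin by simp
  have three: "3 \<le> ?d v" if "v \<in> ?V" for v
  proof -
    have "int (?d v) \<in> set \<pi>" using set that by auto
    then obtain i where i: "i < n" "\<pi> ! i = int (?d v)" using assms(2) by (auto simp: in_set_conv_nth)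
    \<comment> \<open>The last entry is the smallest, and the strict-index lemma for
      \<open>sorted_wrt\<close> leaves the index \<open>n - 1\<close> itself to be treated
      apart.\<close>
    have "\<pi> ! (n - 1) \<le> \<pi> ! i"
    proof (cases "i = n - 1")
      case False
      then show ?thesis using sorted_wrt_nth_less[OF assms(4), of i "n - 1"] i(1) assms(2) by simp
    qed simp
    then show ?thesis using i assms(6) by simp
  qed
  have "\<pi> ! 0 \<in> set \<pi>" using assms(1,2) by (intro nth_mem) auto
  then obtain u where u: "u \<in> ?V" "int (?d u) = \<pi> ! 0" using set by auto
  have hub: "card ?V \<le> ?d u + 3" using u assms(5) card by linarith
  have "\<not> exceptional ?V ?d"
    using exceptional_list[OF fin mset assms(4) three _ assms(2)] assms(7) by blast
  then have "Z3_realizable ?V ?d"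
    using Z3_realizable_nbhd_graph[OF nbhd_graph_of_simple_graph[OF G(1)] _ u(1) hub] three by blast
  then obtain M where M: "simple ?V M" "\<forall>v\<in>?V. deg M v = ?d v" "Z3_conn ?V M"
    unfolding Z3_realizable_def by blast
  have "verts (mgraph_of ?V M) = ?V" by (simp add: mgraph_of_def)
  then have "degree_sequence (mgraph_of ?V M) = degree_sequence G"
    unfolding degree_sequence_def using M(2) fin degree_mgraph_of[OF M(1)]
    by (auto intro!: image_mset_cong)
  then have "realization (mgraph_of ?V M) \<pi>"
    unfolding realization_def using G(2) simple_graph_mgraph_of[OF fin M(1)] by simp
  then show ?thesis
    unfolding has_Z3_connected_realization_def using Z3_connected_mgraph_of[OF M(1,3)] by blast
qed

end
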